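(* Let $\mathcal{A}$ be a locally noetherian Grothendieck category. For every atom $\alpha\in\mathrm{ASpec}\,\mathcal{A}$, the object $H(\alpha)$ is a faithfully $t_\alpha$-injective object.
   Context: A nonzero object $H$ of $\mathcal{A}$ is monoform if for every nonzero subobject $N$ of $H$, no nonzero subobject of $H$ is isomorphic to a subobject of $H/N$. Two monoform objects are atom-equivalent if they have isomorphic nonzero subobjects (this is an equivalence relation); the class of $H$ is denoted $\overline{H}$ and called an atom; $\mathrm{ASpec}\,\mathcal{A}$ is the set of atoms. For an object $M$, $\mathrm{ASupp}(M)$ is the set of atoms $\alpha$ such that some $H\in\alpha$ is a subquotient of $M$. A subset $\Phi\subseteq\mathrm{ASpec}\,\mathcal{A}$ is open if for every $\alpha\in\Phi$ there is $H\in\alpha$ with $\mathrm{ASupp}(H)\subseteq\Phi$. Write $\alpha\le\beta$ if every open subset containing $\alpha$ contains $\beta$; the closure is $\overline{\{\alpha\}}=\{\beta\mid\beta\le\alpha\}$. Let $\mathcal{X}(\alpha)=\{M\in\mathcal{A}\mid \mathrm{ASupp}(M)\subseteq\mathrm{ASpec}\,\mathcal{A}\setminus\overline{\{\alpha\}}\}$, a localizing subcategory, and let $t_\alpha$ be the corresponding left exact radical functor: $t_\alpha(M)$ is the largest subobject of $M$ belonging to $\mathcal{X}(\alpha)$. $E(\alpha)$ denotes the injective envelope of any monoform object $H\in\alpha$ (independent of $H$ up to isomorphism, and indecomposable), and $H(\alpha)$ denotes the unique maximal monoform subobject of $E(\alpha)$ (which exists by a known result of Kanda). For a left exact radical functor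 $\gamma$, an object $X$ is $\gamma$-torsion if $\gamma(X)=X$ and $\gamma$-torsion-free if $\gamma(X)=0$; an object $D$ is faithfully $\gamma$-injective if $\gamma(D)=0$ and $\mathrm{Ext}^1_{\mathcal{A}}(X,D)=0$ for every $\gamma$-torsion object $X$. *)

theory Defs
  imports "HOL-Algebra.Group" "HOL-Library.Equipollence"
begin

section \<open>Preadditive and abelian categories\<close>

text \<open>
  \<open>Comp C g f\<close> is the composite "g after f"; it is only meaningful if \<open>Cod C f = Dom C g\<close>.
\<close>

record ('o, 'm) additive_data =
  Obj :: "'o set"
  Arr :: "'m set"
  Dom :: "'m \<Rightarrow> 'o"
  Cod :: "'m \<Rightarrow> 'o"
  Ident :: "'o \<Rightarrow> 'm"
  Comp :: "'m \<Rightarrow> 'm \<Rightarrow> 'm"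
  MAdd :: "'m \<Rightarrow> 'm \<Rightarrow> 'm"
  MZero :: "'o \<Rightarrow> 'o \<Rightarrow> 'm"

definition Hom :: "('o, 'm, 'x) additive_data_scheme \<Rightarrow> 'o \<Rightarrow> 'o \<Rightarrow> 'm set" where
  "Hom C X Y = {f \<in> Arr C. Dom C f = X \<and> Cod C f = Y}"

locale category =
  fixes C :: "('o, 'm, 'x) additive_data_scheme"
  assumes Dom_Obj: "f \<in> Arr C \<Longrightarrow> Dom C f \<in> Obj C"
    and Cod_Obj: "f \<in> Arr C \<Longrightarrow> Cod C f \<in> Obj C"
    and Ident_Hom: "X \<in> Obj C \<Longrightarrow> Ident C X \<in> Hom C X X"
    and Comp_Hom: "f \<in> Hom C X Y \<Longrightarrow> g \<in> Hom C Y Z \<Longrightarrow> Comp C g f \<in> Hom C X Z"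
    and Comp_Ident_right: "f \<in> Hom C X Y \<Longrightarrow> Comp C f (Ident C X) = f"
    and Comp_Ident_left: "f \<in> Hom C X Y \<Longrightarrow> Comp C (Ident C Y) f = f"
    and Comp_assoc: "f \<in> Hom C W X \<Longrightarrow> g \<in> Hom C X Y \<Longrightarrow> h \<in> Hom C Y Z \<Longrightarrow>
      Comp C h (Comp C g f) = Comp C (Comp C h g) f"

locale preadditive_category = category C
  for C :: "('o, 'm, 'x) additive_data_scheme" +
  assumes Hom_group: "X \<in> Obj C \<Longrightarrow> Y \<in> Obj C \<Longrightarrow>
      comm_group \<lparr>carrier = Hom C X Y, monoid.mult = MAdd C, one = MZero C X Y\<rparr>"
    and Comp_MAdd_right: "f \<in> Hom C X Y \<Longrightarrow> f' \<in> Hom C X Y \<Longrightarrow> g \<in> Hom C Y Z \<Longrightarrow>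
      Comp C g (MAdd C f f') = MAdd C (Comp C g f) (Comp C g f')"
    and Comp_MAdd_left: "f \<in> Hom C X Y \<Longrightarrow> g \<in> Hom C Y Z \<Longrightarrow> g' \<in> Hom C Y Z \<Longrightarrow>
      Comp C (MAdd C g g') f = MAdd C (Comp C g f) (Comp C g' f)"

definition zero_object :: "('o, 'm, 'x) additive_data_scheme \<Rightarrow> 'o \<Rightarrow> bool" where
  "zero_object C Z \<longleftrightarrow> Z \<in> Obj C \<and>
     (\<forall>X\<in>Obj C. (\<exists>!f. f \<in> Hom C X Z) \<and> (\<exists>!f. f \<in> Hom C Z X))"

definition monic :: "('o, 'm, 'x) additive_data_scheme \<Rightarrow> 'm \<Rightarrow> bool" where
  "monic C m \<longleftrightarrow> m \<in> Arr C \<and>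
     (\<forall>X\<in>Obj C. \<forall>f\<in>Hom C X (Dom C m). \<forall>g\<in>Hom C X (Dom C m). Comp C m f = Comp C m g \<longrightarrow> f = g)"

definition epic :: "('o, 'm, 'x) additive_data_scheme \<Rightarrow> 'm \<Rightarrow> bool" where
  "epic C e \<longleftrightarrow> e \<in> Arr C \<and>
     (\<forall>Y\<in>Obj C. \<forall>f\<in>Hom C (Cod C e) Y. \<forall>g\<in>Hom C (Cod C e) Y. Comp C f e = Comp C g e \<longrightarrow> f = g)"

definition isomorphism :: "('o, 'm, 'x) additive_data_scheme \<Rightarrow> 'm \<Rightarrow> bool" where
  "isomorphism C f \<longleftrightarrow> f \<in> Arr C \<and>
     (\<exists>g\<in>Hom C (Cod C f) (Dom C f). Comp C g f = Ident C (Dom C f) \<and> Comp C f g = Ident C (Cod C f))"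

definition isomorphic :: "('o, 'm, 'x) additive_data_scheme \<Rightarrow> 'o \<Rightarrow> 'o \<Rightarrow> bool" where
  "isomorphic C X Y \<longleftrightarrow> (\<exists>f\<in>Hom C X Y. isomorphism C f)"

definition is_kernel :: "('o, 'm, 'x) additive_data_scheme \<Rightarrow> 'm \<Rightarrow> 'm \<Rightarrow> bool" where
  "is_kernel C k f \<longleftrightarrow> f \<in> Arr C \<and> k \<in> Hom C (Dom C k) (Dom C f) \<and>
     Comp C f k = MZero C (Dom C k) (Cod C f) \<and>
     (\<forall>X\<in>Obj C. \<forall>h\<in>Hom C X (Dom C f). Comp C f h = MZero C X (Cod C f) \<longrightarrow>
        (\<exists>!u. u \<in> Hom C X (Dom C k) \<and> Comp C k u = h))"

definition is_cokernel :: "('o, 'm, 'x) additive_data_scheme \<Rightarrow> 'm \<Rightarrow> 'm \<Rightarrow> bool" where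
  "is_cokernel C q f \<longleftrightarrow> f \<in> Arr C \<and> q \<in> Hom C (Cod C f) (Cod C q) \<and>
     Comp C q f = MZero C (Dom C f) (Cod C q) \<and>
     (\<forall>Y\<in>Obj C. \<forall>h\<in>Hom C (Cod C f) Y. Comp C h f = MZero C (Dom C f) Y \<longrightarrow>
        (\<exists>!u. u \<in> Hom C (Cod C q) Y \<and> Comp C u q = h))"

definition is_biproduct ::
    "('o, 'm, 'x) additive_data_scheme \<Rightarrow> 'o \<Rightarrow> 'o \<Rightarrow> 'o \<Rightarrow> 'm \<Rightarrow> 'm \<Rightarrow> 'm \<Rightarrow> 'm \<Rightarrow> bool" where
  "is_biproduct C X Y P i1 i2 p1 p2 \<longleftrightarrow> P \<in> Obj C \<and>
     i1 \<in> Hom C X P \<and> i2 \<in> Hom C Y P \<and> p1 \<in> Hom C P X \<and> p2 \<in> Hom C P Y \<and>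
     Comp C p1 i1 = Ident C X \<and> Comp C p2 i2 = Ident C Y \<and>
     MAdd C (Comp C i1 p1) (Comp C i2 p2) = Ident C P"

locale abelian_category = preadditive_category C
  for C :: "('o, 'm, 'x) additive_data_scheme" +
  assumes zero_object_exists: "\<exists>Z. zero_object C Z"
    and biproduct_exists: "X \<in> Obj C \<Longrightarrow> Y \<in> Obj C \<Longrightarrow> \<exists>P i1 i2 p1 p2. is_biproduct C X Y P i1 i2 p1 p2"
    and kernel_exists: "f \<in> Arr C \<Longrightarrow> \<exists>k. is_kernel C k f"
    and cokernel_exists: "f \<in> Arr C \<Longrightarrow> \<exists>q. is_cokernel C q f"
    and monic_is_kernel: "monic C m \<Longrightarrow> \<exists>f. is_kernel C m f"
    and epic_is_cokernel: "epic C e \<Longrightarrow> \<exists>f. is_cokernel C e f"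


section \<open>Subobjects\<close>

text \<open>
  A subobject of \<open>M\<close> is represented by a monomorphism into \<open>M\<close>; two monomorphisms represent the
  same subobject iff each is below the other with respect to \<open>sub_le\<close>.  The object underlying the
  subobject \<open>m\<close> is \<open>Dom C m\<close>, and the quotient by it is the codomain of a cokernel of \<open>m\<close>.
\<close>

definition subobject :: "('o, 'm, 'x) additive_data_scheme \<Rightarrow> 'o \<Rightarrow> 'm \<Rightarrow> bool" where
  "subobject C M m \<longleftrightarrow> monic C m \<and> Cod C m = M"

definition nonzero_subobject :: "('o, 'm, 'x) additive_data_scheme \<Rightarrow> 'o \<Rightarrow> 'm \<Rightarrow> bool" where
  "nonzero_subobject C M m \<longleftrightarrow> subobject C M m \<and> \<not> zero_object C (Dom C m)"

definition sub_le :: "('o, 'm, 'x) additive_data_scheme \<Rightarrow> 'm \<Rightarrow> 'm \<Rightarrow> bool" where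
  "sub_le C m n \<longleftrightarrow> (\<exists>u\<in>Hom C (Dom C m) (Dom C n). Comp C n u = m)"

definition is_sub_sum ::
    "('o, 'm, 'x) additive_data_scheme \<Rightarrow> 'o \<Rightarrow> 'i set \<Rightarrow> ('i \<Rightarrow> 'm) \<Rightarrow> 'm \<Rightarrow> bool" where
  "is_sub_sum C M I m s \<longleftrightarrow> subobject C M s \<and> (\<forall>i\<in>I. sub_le C (m i) s) \<and>
     (\<forall>t. subobject C M t \<and> (\<forall>i\<in>I. sub_le C (m i) t) \<longrightarrow> sub_le C s t)"

definition is_sub_inter ::
    "('o, 'm, 'x) additive_data_scheme \<Rightarrow> 'o \<Rightarrow> 'm \<Rightarrow> 'm \<Rightarrow> 'm \<Rightarrow> bool" where
  "is_sub_inter C M m n d \<longleftrightarrow> subobject C M d \<and> sub_le C d m \<and> sub_le C d n \<and>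
     (\<forall>t. subobject C M t \<and> sub_le C t m \<and> sub_le C t n \<longrightarrow> sub_le C t d)"

definition subquotient :: "('o, 'm, 'x) additive_data_scheme \<Rightarrow> 'o \<Rightarrow> 'o \<Rightarrow> bool" where
  "subquotient C K M \<longleftrightarrow> (\<exists>s q. subobject C M s \<and> epic C q \<and> Dom C q = Dom C s \<and> Cod C q = K)"


section \<open>Locally noetherian Grothendieck categories\<close>

text \<open>
  The type \<open>'u\<close> plays the role of the universe: the small sets are those whose cardinality is
  strictly below that of \<open>'u\<close>, as for a Grothendieck universe.  Every small set then injects into
  \<open>'u\<close>, so it is enough to consider small families indexed by subsets of \<open>'u\<close>.
\<close>

definition small :: "'u itself \<Rightarrow> 'a set \<Rightarrow> bool" where
  "small _ S \<longleftrightarrow> S \<prec> (UNIV :: 'u set)"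

definition is_coproduct ::
    "('o, 'm, 'x) additive_data_scheme \<Rightarrow> 'i set \<Rightarrow> ('i \<Rightarrow> 'o) \<Rightarrow> 'o \<Rightarrow> ('i \<Rightarrow> 'm) \<Rightarrow> bool" where
  "is_coproduct C I F S \<iota> \<longleftrightarrow> S \<in> Obj C \<and> (\<forall>i\<in>I. \<iota> i \<in> Hom C (F i) S) \<and>
     (\<forall>T\<in>Obj C. \<forall>g. (\<forall>i\<in>I. g i \<in> Hom C (F i) T) \<longrightarrow>
        (\<exists>!u. u \<in> Hom C S T \<and> (\<forall>i\<in>I. Comp C u (\<iota> i) = g i)))"

definition AB3 :: "'u itself \<Rightarrow> ('o, 'm, 'x) additive_data_scheme \<Rightarrow> bool" where
  "AB3 U C \<longleftrightarrow> (\<forall>(I :: 'u set) F. small U I \<and> (\<forall>i\<in>I. F i \<in> Obj C) \<longrightarrow>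
     (\<exists>S \<iota>. is_coproduct C I F S \<iota>))"

text \<open>
  Condition AB5 in Grothendieck's original (Tohoku) form: intersection with a subobject
  distributes over sums of directed families of subobjects.
\<close>

definition AB5 :: "'u itself \<Rightarrow> ('o, 'm, 'x) additive_data_scheme \<Rightarrow> bool" where
  "AB5 U C \<longleftrightarrow> AB3 U C \<and>
     (\<forall>M\<in>Obj C. \<forall>(I :: 'u set) a b s c d.
        small U I \<and> I \<noteq> {} \<and> (\<forall>i\<in>I. subobject C M (a i)) \<and>
        (\<forall>i\<in>I. \<forall>j\<in>I. \<exists>k\<in>I. sub_le C (a i) (a k) \<and> sub_le C (a j) (a k)) \<and>
        subobject C M b \<and> is_sub_sum C M I a s \<and>
        (\<forall>i\<in>I. is_sub_inter C M (a i) b (c i)) \<and> is_sub_inter C M s b d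
        \<longrightarrow> is_sub_sum C M I c d)"

definition generating_set :: "('o, 'm, 'x) additive_data_scheme \<Rightarrow> 'o set \<Rightarrow> bool" where
  "generating_set C \<G> \<longleftrightarrow> \<G> \<subseteq> Obj C \<and>
     (\<forall>X\<in>Obj C. \<forall>Y\<in>Obj C. \<forall>f\<in>Hom C X Y. \<forall>g\<in>Hom C X Y.
        f \<noteq> g \<longrightarrow> (\<exists>G\<in>\<G>. \<exists>h\<in>Hom C G X. Comp C f h \<noteq> Comp C g h))"

text \<open>
  The universe is uncountable, so that countable families are small.  Inaccessibility of the universe
  and smallness of the hom sets are not imposed: every Grothendieck category relative to a
  Grothendieck universe satisfies the definition.
\<close>

definition grothendieck_category :: "'u itself \<Rightarrow> ('o, 'm, 'x) additive_data_scheme \<Rightarrow> bool" where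
  "grothendieck_category U C \<longleftrightarrow> small U (UNIV :: nat set) \<and>
     abelian_category C \<and> AB5 U C \<and> (\<exists>G\<in>Obj C. generating_set C {G})"

definition noetherian_object :: "('o, 'm, 'x) additive_data_scheme \<Rightarrow> 'o \<Rightarrow> bool" where
  "noetherian_object C M \<longleftrightarrow> M \<in> Obj C \<and>
     (\<forall>a :: nat \<Rightarrow> 'm. (\<forall>n. subobject C M (a n) \<and> sub_le C (a n) (a (Suc n))) \<longrightarrow>
        (\<exists>N. \<forall>n\<ge>N. sub_le C (a n) (a N)))"

definition locally_noetherian_grothendieck_category ::
    "'u itself \<Rightarrow> ('o, 'm, 'x) additive_data_scheme \<Rightarrow> bool" where
  "locally_noetherian_grothendieck_category U C \<longleftrightarrow> grothendieck_category U C \<and>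
     (\<exists>\<G>. small U \<G> \<and> generating_set C \<G> \<and> (\<forall>G\<in>\<G>. noetherian_object C G))"


section \<open>The atom spectrum\<close>

definition monoform :: "('o, 'm, 'x) additive_data_scheme \<Rightarrow> 'o \<Rightarrow> bool" where
  "monoform C H \<longleftrightarrow> H \<in> Obj C \<and> \<not> zero_object C H \<and>
     (\<forall>n q. nonzero_subobject C H n \<and> is_cokernel C q n \<longrightarrow>
        \<not> (\<exists>s t. nonzero_subobject C H s \<and> subobject C (Cod C q) t \<and> isomorphic C (Dom C s) (Dom C t)))"

definition atom_rel :: "('o, 'm, 'x) additive_data_scheme \<Rightarrow> ('o \<times> 'o) set" where
  "atom_rel C = {(H, K). monoform C H \<and> monoform C K \<and>
     (\<exists>s t. nonzero_subobject C H s \<and> nonzero_subobject C K t \<and> isomorphic C (Dom C s) (Dom C t))}"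

definition ASpec :: "('o, 'm, 'x) additive_data_scheme \<Rightarrow> 'o set set" where
  "ASpec C = {H. monoform C H} // atom_rel C"

definition ASupp :: "('o, 'm, 'x) additive_data_scheme \<Rightarrow> 'o \<Rightarrow> 'o set set" where
  "ASupp C M = {\<alpha> \<in> ASpec C. \<exists>H\<in>\<alpha>. subquotient C H M}"

definition atom_open :: "('o, 'm, 'x) additive_data_scheme \<Rightarrow> 'o set set \<Rightarrow> bool" where
  "atom_open C \<Phi> \<longleftrightarrow> \<Phi> \<subseteq> ASpec C \<and> (\<forall>\<alpha>\<in>\<Phi>. \<exists>H\<in>\<alpha>. ASupp C H \<subseteq> \<Phi>)"

definition atom_le :: "('o, 'm, 'x) additive_data_scheme \<Rightarrow> 'o set \<Rightarrow> 'o set \<Rightarrow> bool" where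
  "atom_le C \<alpha> \<beta> \<longleftrightarrow> (\<forall>\<Phi>. atom_open C \<Phi> \<and> \<alpha> \<in> \<Phi> \<longrightarrow> \<beta> \<in> \<Phi>)"

definition atom_closure :: "('o, 'm, 'x) additive_data_scheme \<Rightarrow> 'o set \<Rightarrow> 'o set set" where
  "atom_closure C \<alpha> = {\<beta> \<in> ASpec C. atom_le C \<beta> \<alpha>}"


section \<open>The localizing subcategory of an atom and its radical\<close>

definition localizing_at :: "('o, 'm, 'x) additive_data_scheme \<Rightarrow> 'o set \<Rightarrow> 'o set" where
  "localizing_at C \<alpha> = {M \<in> Obj C. ASupp C M \<subseteq> ASpec C - atom_closure C \<alpha>}"

text \<open>
  A radical functor \<open>\<gamma>\<close> is represented by the family of the inclusions \<open>\<gamma> M\<close> of the subobjects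
  \<gamma>(M) into M; thus the object \<gamma>(M) is \<open>Dom C (\<gamma> M)\<close>.  The action on morphisms is by restriction
  and hence determined by the family.  The following says that \<open>\<gamma>\<close> is (a choice of) the functor
  that sends every object to its largest subobject belonging to \<open>localizing_at C \<alpha>\<close>.
\<close>

definition is_radical_at ::
    "('o, 'm, 'x) additive_data_scheme \<Rightarrow> 'o set \<Rightarrow> ('o \<Rightarrow> 'm) \<Rightarrow> bool" where
  "is_radical_at C \<alpha> \<gamma> \<longleftrightarrow> (\<forall>M\<in>Obj C.
     subobject C M (\<gamma> M) \<and> Dom C (\<gamma> M) \<in> localizing_at C \<alpha> \<and>
     (\<forall>s. subobject C M s \<and> Dom C s \<in> localizing_at C \<alpha> \<longrightarrow> sub_le C s (\<gamma> M)))"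

definition torsion :: "('o, 'm, 'x) additive_data_scheme \<Rightarrow> ('o \<Rightarrow> 'm) \<Rightarrow> 'o \<Rightarrow> bool" where
  "torsion C \<gamma> X \<longleftrightarrow> X \<in> Obj C \<and> isomorphism C (\<gamma> X)"

definition torsion_free :: "('o, 'm, 'x) additive_data_scheme \<Rightarrow> ('o \<Rightarrow> 'm) \<Rightarrow> 'o \<Rightarrow> bool" where
  "torsion_free C \<gamma> X \<longleftrightarrow> X \<in> Obj C \<and> zero_object C (Dom C (\<gamma> X))"

text \<open>
  \<open>extensions C X D\<close> consists of the short exact sequences \<open>0 \<rightarrow> D \<rightarrow> Y \<rightarrow> X \<rightarrow> 0\<close>, and \<open>Ext1 C X D\<close>
  is the underlying set of the Yoneda group \<open>Ext\<^sup>1(X, D)\<close>.  A group is zero iff it has exactly one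
  element, so the vanishing of \<open>Ext\<^sup>1(X, D)\<close> is expressed as \<open>is_singleton (Ext1 C X D)\<close>.
\<close>

definition extensions :: "('o, 'm, 'x) additive_data_scheme \<Rightarrow> 'o \<Rightarrow> 'o \<Rightarrow> ('m \<times> 'm) set" where
  "extensions C X D = {(i, p). Dom C i = D \<and> Cod C p = X \<and> is_kernel C i p \<and> is_cokernel C p i}"

definition ext_rel :: "('o, 'm, 'x) additive_data_scheme \<Rightarrow> 'o \<Rightarrow> 'o \<Rightarrow> (('m \<times> 'm) \<times> ('m \<times> 'm)) set" where
  "ext_rel C X D = {((i, p), (i', p')). (i, p) \<in> extensions C X D \<and> (i', p') \<in> extensions C X D \<and>
     (\<exists>f\<in>Hom C (Cod C i) (Cod C i'). isomorphism C f \<and> Comp C f i = i' \<and> Comp C p' f = p)}"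

definition Ext1 :: "('o, 'm, 'x) additive_data_scheme \<Rightarrow> 'o \<Rightarrow> 'o \<Rightarrow> ('m \<times> 'm) set set" where
  "Ext1 C X D = extensions C X D // ext_rel C X D"

definition faithfully_injective ::
    "('o, 'm, 'x) additive_data_scheme \<Rightarrow> ('o \<Rightarrow> 'm) \<Rightarrow> 'o \<Rightarrow> bool" where
  "faithfully_injective C \<gamma> D \<longleftrightarrow> torsion_free C \<gamma> D \<and>
     (\<forall>X. torsion C \<gamma> X \<longrightarrow> is_singleton (Ext1 C X D))"


section \<open>Injective envelopes\<close>

definition injective_object :: "('o, 'm, 'x) additive_data_scheme \<Rightarrow> 'o \<Rightarrow> bool" where
  "injective_object C E \<longleftrightarrow> E \<in> Obj C \<and>
     (\<forall>m f. monic C m \<and> f \<in> Hom C (Dom C m) E \<longrightarrow> (\<exists>g\<in>Hom C (Cod C m) E. Comp C g m = f))"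

definition essential_monic :: "('o, 'm, 'x) additive_data_scheme \<Rightarrow> 'm \<Rightarrow> bool" where
  "essential_monic C m \<longleftrightarrow> monic C m \<and>
     (\<forall>s d. nonzero_subobject C (Cod C m) s \<and> is_sub_inter C (Cod C m) m s d \<longrightarrow>
        \<not> zero_object C (Dom C d))"

definition is_injective_envelope ::
    "('o, 'm, 'x) additive_data_scheme \<Rightarrow> 'o \<Rightarrow> 'o \<Rightarrow> 'm \<Rightarrow> bool" where
  "is_injective_envelope C H E e \<longleftrightarrow> e \<in> Hom C H E \<and> essential_monic C e \<and> injective_object C E"

text \<open>
  \<open>E(\<alpha>)\<close> is defined only up to isomorphism and \<open>H(\<alpha>)\<close> only up to the choice of a representing
  monomorphism, so both are rendered as relations.
\<close>

definition is_atom_envelope :: "('o, 'm, 'x) additive_data_scheme \<Rightarrow> 'o set \<Rightarrow> 'o \<Rightarrow> bool" where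
  "is_atom_envelope C \<alpha> E \<longleftrightarrow> (\<exists>H\<in>\<alpha>. \<exists>e. is_injective_envelope C H E e)"

definition maximal_monoform_subobject ::
    "('o, 'm, 'x) additive_data_scheme \<Rightarrow> 'o \<Rightarrow> 'm \<Rightarrow> bool" where
  "maximal_monoform_subobject C E h \<longleftrightarrow> subobject C E h \<and> monoform C (Dom C h) \<and>
     (\<forall>s. subobject C E s \<and> monoform C (Dom C s) \<and> sub_le C h s \<longrightarrow> sub_le C s h)"

end

(* Given an extension Y of a torsion object X by H = H(alpha), extend the inclusion of H into the
   injective E(alpha) to Y, with image K. The object K is uniform, and K/H is a quotient of X, so no
   object of alpha is a subquotient of K/H; this forces K to be monoform. By maximality K = H, and
   the map from Y onto K splits the extension. *)

theory Submission
  imports Defs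
begin

text \<open>Monoformness of K could fail through any nonzero subobject S of K, not only through
  subobjects of H. Uniformity is what makes the exclusion of objects of \<alpha> sufficient: S meets
  H in a nonzero V, and V, being a monoform subobject of E(\<alpha>), lies in \<alpha>. Here
  E(\<alpha>) is uniform as an essential extension of a monoform object H' in \<alpha>, and a
  monoform subobject of it lies in \<alpha> because it meets H'. Torsion is exploited through the
  fact that \<alpha> belongs to its own closure: an object of the localizing subcategory has no
  subquotient in \<alpha>. The same facts give torsion-freeness, since a nonzero t(H) would lie in
  \<alpha> and be a subquotient of itself. Vanishing of Ext means here that there is exactly one
  class of extensions. Retractions must therefore be turned into an isomorphism between any two
  extensions, and the biproduct has to supply at least one.\<close>

context category
begin

section \<open>Arrows, monics and epics in a category\<close>

abbreviation comp (infixr "\<cdot>" 70) where "g \<cdot> f \<equiv> Comp C g f"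

lemma Hom_iff: "f \<in> Hom C X Y \<longleftrightarrow> f \<in> Arr C \<and> Dom C f = X \<and> Cod C f = Y"
  by (simp add: Hom_def)

text \<open>Typing goes through \<open>Dom\<close> and \<open>Cod\<close> here: in the
  \<open>Hom\<close> form of the axioms, intermediate objects do not occur in the conclusion, so a
  rewrite rule could not instantiate them. \<open>Hom_iff\<close> translates between the two
  forms.\<close>

lemma Comp_arrow [simp]:
  assumes "f \<in> Arr C" "g \<in> Arr C" "Cod C f = Dom C g"
  shows "g \<cdot> f \<in> Arr C" "Dom C (g \<cdot> f) = Dom C f" "Cod C (g \<cdot> f) = Cod C g"
  using Comp_Hom[of f "Dom C f" "Dom C g" g "Cod C g"] assms by (auto simp: Hom_iff)

lemma Comp_assoc_arrow [simp]:
  assumes "f \<in> Arr C" "g \<in> Arr C" "h \<in> Arr C" "Cod C f = Dom C g" "Cod C g = Dom C h"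
  shows "(h \<cdot> g) \<cdot> f = h \<cdot> g \<cdot> f"
  using Comp_assoc[of f "Dom C f" "Dom C g" g "Dom C h" h "Cod C h"] assms by (auto simp: Hom_iff)

lemma Ident_arrow [simp]:
  assumes "X \<in> Obj C"
  shows "Ident C X \<in> Arr C" "Dom C (Ident C X) = X" "Cod C (Ident C X) = X"
  using Ident_Hom[OF assms] by (auto simp: Hom_iff)

lemma Comp_Ident_arrow [simp]:
  assumes "f \<in> Arr C"
  shows "Dom C f = X \<Longrightarrow> f \<cdot> Ident C X = f" "Cod C f = X \<Longrightarrow> Ident C X \<cdot> f = f"
  using assms Comp_Ident_right Comp_Ident_left by (auto simp: Hom_iff)

lemma Hom_Obj: "f \<in> Hom C X Y \<Longrightarrow> X \<in> Obj C" "f \<in> Hom C X Y \<Longrightarrow> Y \<in> Obj C"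
  using Dom_Obj Cod_Obj by (auto simp: Hom_iff)

lemma monic_arrow: "monic C m \<Longrightarrow> m \<in> Arr C"
  by (simp add: monic_def)

lemma epic_arrow: "epic C e \<Longrightarrow> e \<in> Arr C"
  by (simp add: epic_def)

lemma monic_cancel:
  assumes "monic C m" "f \<in> Hom C X (Dom C m)" "g \<in> Hom C X (Dom C m)" "m \<cdot> f = m \<cdot> g"
  shows "f = g"
  using assms Hom_Obj(1) unfolding monic_def by blast

lemma epic_cancel:
  assumes "epic C e" "f \<in> Hom C (Cod C e) Y" "g \<in> Hom C (Cod C e) Y" "f \<cdot> e = g \<cdot> e"
  shows "f = g"
  using assms Hom_Obj(2) unfolding epic_def by blast

text \<open>The equation comes first so that a chained fact fixes \<open>f\<close> and
  \<open>g\<close>; \<open>X\<close> stands in place of \<open>Dom C m\<close> so that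
  \<open>Hom\<close> facts fit directly.\<close>

lemma monic_cancel_Hom:
  assumes "m \<cdot> f = m \<cdot> g" "monic C m" "m \<in> Hom C X Y" "f \<in> Hom C W X" "g \<in> Hom C W X"
  shows "f = g"
  using monic_cancel[of m f W g] assms by (auto simp: Hom_iff)

lemma epic_cancel_Hom:
  assumes "f \<cdot> e = g \<cdot> e" "epic C e" "e \<in> Hom C X Y" "f \<in> Hom C Y Z" "g \<in> Hom C Y Z"
  shows "f = g"
  using epic_cancel[of e f Z g] assms by (auto simp: Hom_iff)

lemma monic_Comp:
  assumes "monic C m" "monic C n" "Cod C n = Dom C m"
  shows "monic C (m \<cdot> n)"
  unfolding monic_def
proof (intro conjI ballI impI)
  note [simp] = assms(1,2)[THEN monic_arrow] assms(3)
  show "m \<cdot> n \<in> Arr C" by simp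
  fix X f g assume f: "f \<in> Hom C X (Dom C (m \<cdot> n))" and g: "g \<in> Hom C X (Dom C (m \<cdot> n))"
    and eq: "(m \<cdot> n) \<cdot> f = (m \<cdot> n) \<cdot> g"
  have nfg: "n \<cdot> f = n \<cdot> g"
    by (rule monic_cancel[OF assms(1), of _ X]) (use f g eq in \<open>auto simp: Hom_iff\<close>)
  show "f = g"
    by (rule monic_cancel[OF assms(2), of _ X]) (use f g nfg in \<open>auto simp: Hom_iff\<close>)
qed

lemma epic_Comp:
  assumes "epic C e" "epic C d" "Cod C d = Dom C e"
  shows "epic C (e \<cdot> d)"
  unfolding epic_def
proof (intro conjI ballI impI)
  note [simp] = assms(1,2)[THEN epic_arrow] assms(3)
  show "e \<cdot> d \<in> Arr C" by simp
  fix X f g assume f: "f \<in> Hom C (Cod C (e \<cdot> d)) X" and g: "g \<in> Hom C (Cod C (e \<cdot> d)) X"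
    and eq: "f \<cdot> (e \<cdot> d) = g \<cdot> (e \<cdot> d)"
  have feg: "f \<cdot> e = g \<cdot> e"
    by (rule epic_cancel[OF assms(2), of _ X]) (use f g eq in \<open>auto simp: Hom_iff\<close>)
  show "f = g"
    by (rule epic_cancel[OF assms(1), of _ X]) (use f g feg in \<open>auto simp: Hom_iff\<close>)
qed

lemma monic_right_factor:
  assumes "monic C (m \<cdot> n)" "n \<in> Hom C X Y" "m \<in> Hom C Y Z"
  shows "monic C n"
  unfolding monic_def
proof (intro conjI ballI impI)
  show "n \<in> Arr C" using assms by (simp add: Hom_iff)
  fix W f g assume f: "f \<in> Hom C W (Dom C n)" and g: "g \<in> Hom C W (Dom C n)" and eq: "n \<cdot> f = n \<cdot> g"
  show "f = g"
    by (rule monic_cancel[OF assms(1), of _ W]) (use f g eq assms in \<open>auto simp: Hom_iff\<close>)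
qed

lemma epic_left_factor:
  assumes "epic C (e \<cdot> d)" "d \<in> Hom C X Y" "e \<in> Hom C Y Z"
  shows "epic C e"
  unfolding epic_def
proof (intro conjI ballI impI)
  show "e \<in> Arr C" using assms by (simp add: Hom_iff)
  fix W f g assume f: "f \<in> Hom C (Cod C e) W" and g: "g \<in> Hom C (Cod C e) W" and eq: "f \<cdot> e = g \<cdot> e"
  have "f \<cdot> e \<cdot> d = (f \<cdot> e) \<cdot> d" using f assms by (auto simp: Hom_iff)
  also have "\<dots> = g \<cdot> e \<cdot> d" using eq g assms by (auto simp: Hom_iff)
  finally have fed: "f \<cdot> e \<cdot> d = g \<cdot> e \<cdot> d" .
  show "f = g"
    by (rule epic_cancel[OF assms(1), of _ W]) (use f g fed assms in \<open>auto simp: Hom_iff\<close>)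
qed

lemma monic_Ident: "X \<in> Obj C \<Longrightarrow> monic C (Ident C X)"
  by (auto simp: monic_def Hom_iff)

lemma epic_Ident: "X \<in> Obj C \<Longrightarrow> epic C (Ident C X)"
  by (auto simp: epic_def Hom_iff)

lemma isomorphic_refl: "X \<in> Obj C \<Longrightarrow> isomorphic C X X"
  unfolding isomorphic_def isomorphism_def
  by (rule bexI[of _ "Ident C X"]) (auto simp: Hom_iff)

lemma isomorphism_monic: assumes "isomorphism C f" shows "monic C f"
proof -
  obtain g where "g \<in> Hom C (Cod C f) (Dom C f)" "g \<cdot> f = Ident C (Dom C f)" "f \<in> Arr C"
    using assms by (auto simp: isomorphism_def)
  then show ?thesis
    by (intro monic_right_factor[of g f "Dom C f" "Cod C f" "Dom C f"])
       (auto simp: Hom_iff intro: monic_Ident Dom_Obj)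
qed

lemma isomorphism_epic: assumes "isomorphism C f" shows "epic C f"
proof -
  obtain g where "g \<in> Hom C (Cod C f) (Dom C f)" "f \<cdot> g = Ident C (Cod C f)" "f \<in> Arr C"
    using assms by (auto simp: isomorphism_def)
  then show ?thesis
    by (intro epic_left_factor[of f g "Cod C f" "Dom C f" "Cod C f"])
       (auto simp: Hom_iff intro: epic_Ident Cod_Obj)
qed

end

section \<open>Zero morphisms, kernels and cokernels\<close>

context preadditive_category
begin

lemma MZero_Hom: "X \<in> Obj C \<Longrightarrow> Y \<in> Obj C \<Longrightarrow> MZero C X Y \<in> Hom C X Y"
proof -
  assume "X \<in> Obj C" "Y \<in> Obj C"
  then interpret comm_group "\<lparr>carrier = Hom C X Y, monoid.mult = MAdd C, one = MZero C X Y\<rparr>"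
    by (rule Hom_group)
  show ?thesis using one_closed by simp
qed

lemma MZero_arrow [simp]:
  assumes "X \<in> Obj C" "Y \<in> Obj C"
  shows "MZero C X Y \<in> Arr C" "Dom C (MZero C X Y) = X" "Cod C (MZero C X Y) = Y"
  using MZero_Hom[OF assms] by (auto simp: Hom_iff)

lemma MAdd_Hom:
  assumes "f \<in> Hom C X Y" "g \<in> Hom C X Y"
  shows "MAdd C f g \<in> Hom C X Y"
proof -
  interpret comm_group "\<lparr>carrier = Hom C X Y, monoid.mult = MAdd C, one = MZero C X Y\<rparr>"
    using Hom_group Hom_Obj assms(1) by blast
  show ?thesis using m_closed[of f g] assms by simp
qed

lemma MAdd_MZero:
  assumes "f \<in> Hom C X Y"
  shows "MAdd C f (MZero C X Y) = f" "MAdd C (MZero C X Y) f = f"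
proof -
  interpret comm_group "\<lparr>carrier = Hom C X Y, monoid.mult = MAdd C, one = MZero C X Y\<rparr>"
    using Hom_group Hom_Obj assms(1) by blast
  show "MAdd C f (MZero C X Y) = f" "MAdd C (MZero C X Y) f = f"
    using r_one[of f] l_one[of f] assms by simp_all
qed

text \<open>Cancellation of \<open>g\<close> in the hom group. Combined with additivity of
  composition, it proves vanishing without mentioning negatives.\<close>

lemma MAdd_eq_self:
  assumes "f \<in> Hom C X Y" "g \<in> Hom C X Y" "MAdd C f g = g"
  shows "f = MZero C X Y"
proof -
  interpret comm_group "\<lparr>carrier = Hom C X Y, monoid.mult = MAdd C, one = MZero C X Y\<rparr>"
    using Hom_group Hom_Obj assms(1) by blast
  show ?thesis using r_cancel_one[of g f] assms by simp
qed

text \<open>The record \<open>additive_data\<close> carries no subtraction, so a difference enters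
  as a witness \<open>d\<close>; group inverses stay inside this proof.\<close>

lemma difference_exists:
  assumes "f \<in> Hom C X Y" "g \<in> Hom C X Y"
  obtains d where "d \<in> Hom C X Y" "f = MAdd C d g"
proof -
  let ?G = "\<lparr>carrier = Hom C X Y, monoid.mult = MAdd C, one = MZero C X Y\<rparr>"
  interpret comm_group ?G
    using Hom_group Hom_Obj assms(1) by blast
  show ?thesis
    using that[of "f \<otimes>\<^bsub>?G\<^esub> inv\<^bsub>?G\<^esub> g"] m_closed[of f "inv\<^bsub>?G\<^esub> g"] inv_closed[of g]
      m_assoc[of f "inv\<^bsub>?G\<^esub> g" g] l_inv[of g] r_one[of f] assms
    by simp
qed

lemma Comp_MZero:
  assumes "f \<in> Hom C X Y" "Z \<in> Obj C"
  shows "f \<cdot> MZero C Z X = MZero C Z Y" "MZero C Y Z \<cdot> f = MZero C X Z"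
proof -
  have [simp]: "X \<in> Obj C" "Y \<in> Obj C" using assms Hom_Obj by auto
  let ?z = "MZero C Z X" let ?w = "MZero C Y Z"
  have z: "?z \<in> Hom C Z X" and w: "?w \<in> Hom C Y Z" using assms(2) by (simp_all add: MZero_Hom)
  have "MAdd C (f \<cdot> ?z) (f \<cdot> ?z) = f \<cdot> ?z"
    using Comp_MAdd_right[OF z z assms(1)] MAdd_MZero[OF z] by simp
  then show "f \<cdot> ?z = MZero C Z Y" using MAdd_eq_self Comp_Hom[OF z assms(1)] by blast
  have "MAdd C (?w \<cdot> f) (?w \<cdot> f) = ?w \<cdot> f"
    using Comp_MAdd_left[OF assms(1) w w] MAdd_MZero[OF w] by simp
  then show "?w \<cdot> f = MZero C X Z" using MAdd_eq_self Comp_Hom[OF assms(1) w] by blast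
qed

lemma Comp_MZero_arrow [simp]:
  assumes "f \<in> Arr C" "Z \<in> Obj C"
  shows "Dom C f = X \<Longrightarrow> f \<cdot> MZero C Z X = MZero C Z (Cod C f)"
    "Cod C f = Y \<Longrightarrow> MZero C Y Z \<cdot> f = MZero C (Dom C f) Z"
  using Comp_MZero[of f "Dom C f" "Cod C f" Z] assms by (auto simp: Hom_iff)

text \<open>If \<open>m \<cdot> f = m \<cdot> g\<close>, additivity shows that \<open>m\<close>
  kills the difference of \<open>f\<close> and \<open>g\<close>, so testing against zero is
  enough.\<close>

lemma monicI_zero:
  assumes m: "m \<in> Hom C Y Z"
    and zero: "\<And>X x. x \<in> Hom C X Y \<Longrightarrow> m \<cdot> x = MZero C X Z \<Longrightarrow> x = MZero C X Y"
  shows "monic C m"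
  unfolding monic_def
proof (intro conjI ballI impI)
  show "m \<in> Arr C" using m by (simp add: Hom_iff)
  fix X f g assume "f \<in> Hom C X (Dom C m)" "g \<in> Hom C X (Dom C m)" and eq: "m \<cdot> f = m \<cdot> g"
  then have f: "f \<in> Hom C X Y" and g: "g \<in> Hom C X Y" using m by (auto simp: Hom_iff)
  obtain d where d: "d \<in> Hom C X Y" "f = MAdd C d g" using difference_exists[OF f g] .
  have "MAdd C (m \<cdot> d) (m \<cdot> g) = m \<cdot> g" using Comp_MAdd_right[OF d(1) g m] eq d(2) by simp
  then have "m \<cdot> d = MZero C X Z" using MAdd_eq_self Comp_Hom d(1) g m by blast
  then have "d = MZero C X Y" using zero d(1) by blast
  then show "f = g" using d(2) MAdd_MZero g by simp
qed

lemma epicI_zero: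
  assumes e: "e \<in> Hom C X Y"
    and zero: "\<And>Z x. x \<in> Hom C Y Z \<Longrightarrow> x \<cdot> e = MZero C X Z \<Longrightarrow> x = MZero C Y Z"
  shows "epic C e"
  unfolding epic_def
proof (intro conjI ballI impI)
  show "e \<in> Arr C" using e by (simp add: Hom_iff)
  fix Z f g assume "f \<in> Hom C (Cod C e) Z" "g \<in> Hom C (Cod C e) Z" and eq: "f \<cdot> e = g \<cdot> e"
  then have f: "f \<in> Hom C Y Z" and g: "g \<in> Hom C Y Z" using e by (auto simp: Hom_iff)
  obtain d where d: "d \<in> Hom C Y Z" "f = MAdd C d g" using difference_exists[OF f g] .
  have "MAdd C (d \<cdot> e) (g \<cdot> e) = g \<cdot> e" using Comp_MAdd_left[OF e d(1) g] eq d(2) by simp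
  then have "d \<cdot> e = MZero C X Z" using MAdd_eq_self Comp_Hom d(1) g e by blast
  then have "d = MZero C Y Z" using zero d(1) by blast
  then show "f = g" using d(2) MAdd_MZero g by simp
qed

lemma monic_zeroD:
  assumes "monic C m" "m \<in> Hom C Y Z" "x \<in> Hom C X Y" "m \<cdot> x = MZero C X Z"
  shows "x = MZero C X Y"
proof (rule monic_cancel[OF assms(1), of _ X])
  have "X \<in> Obj C" "Y \<in> Obj C" using Hom_Obj assms by auto
  then show "m \<cdot> x = m \<cdot> MZero C X Y" "MZero C X Y \<in> Hom C X (Dom C m)" "x \<in> Hom C X (Dom C m)"
    using assms by (auto simp: Hom_iff)
qed

lemma epic_zeroD:
  assumes "epic C e" "e \<in> Hom C X Y" "x \<in> Hom C Y Z" "x \<cdot> e = MZero C X Z"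
  shows "x = MZero C Y Z"
proof (rule epic_cancel[OF assms(1), of _ Z])
  have "Z \<in> Obj C" "Y \<in> Obj C" using Hom_Obj assms by auto
  then show "x \<cdot> e = MZero C Y Z \<cdot> e" "MZero C Y Z \<in> Hom C (Cod C e) Z" "x \<in> Hom C (Cod C e) Z"
    using assms by (auto simp: Hom_iff)
qed

lemma zero_object_Hom:
  assumes "zero_object C Z"
  shows "f \<in> Hom C Z X \<Longrightarrow> f = MZero C Z X" "f \<in> Hom C X Z \<Longrightarrow> f = MZero C X Z"
  using assms MZero_Hom Hom_Obj unfolding zero_object_def by metis+

lemma zero_object_iff: "zero_object C X \<longleftrightarrow> X \<in> Obj C \<and> Ident C X = MZero C X X"
proof
  assume "zero_object C X"
  then show "X \<in> Obj C \<and> Ident C X = MZero C X X"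
    using zero_object_Hom(1) Ident_Hom by (auto simp: zero_object_def)
next
  assume X: "X \<in> Obj C \<and> Ident C X = MZero C X X"
  have "f = MZero C Y X" if "f \<in> Hom C Y X" for f Y
    using that X Comp_Ident_left[OF that] Comp_MZero(2)[OF that, of X] by simp
  moreover have "f = MZero C X Y" if "f \<in> Hom C X Y" for f Y
    using that X Comp_Ident_right[OF that] Comp_MZero(1)[OF that, of X] by simp
  ultimately show "zero_object C X"
    unfolding zero_object_def using X MZero_Hom by metis
qed

lemma zero_monic:
  assumes "monic C m" "m \<in> Hom C X Y" "m = MZero C X Y"
  shows "zero_object C X"
proof -
  have X: "X \<in> Obj C" using Hom_Obj assms by auto
  have "Ident C X = MZero C X X"
    using monic_zeroD[OF assms(1,2) Ident_Hom[OF X]] Comp_Ident_right[OF assms(2)] assms(3) by simp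
  then show ?thesis using X by (simp add: zero_object_iff)
qed

lemma monic_into_zero:
  assumes "monic C m" "m \<in> Hom C X Y" "zero_object C Y"
  shows "zero_object C X"
  using zero_monic zero_object_Hom assms by blast

lemma kernel_Hom:
  assumes "is_kernel C k f" "f \<in> Hom C X Y"
  shows "k \<in> Hom C (Dom C k) X" "f \<cdot> k = MZero C (Dom C k) Y"
  using assms by (auto simp: is_kernel_def Hom_iff)

lemma cokernel_Hom:
  assumes "is_cokernel C q f" "f \<in> Hom C X Y"
  shows "q \<in> Hom C Y (Cod C q)" "q \<cdot> f = MZero C X (Cod C q)"
  using assms by (auto simp: is_cokernel_def Hom_iff)

lemma kernel_factor:
  assumes "is_kernel C k f" "f \<in> Hom C X Y" "x \<in> Hom C W X" "f \<cdot> x = MZero C W Y"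
  obtains u where "u \<in> Hom C W (Dom C k)" "k \<cdot> u = x"
proof -
  have "W \<in> Obj C" "Dom C f = X" "Cod C f = Y" using assms Hom_Obj by (auto simp: Hom_iff)
  then show ?thesis using that assms unfolding is_kernel_def by metis
qed

lemma cokernel_factor:
  assumes "is_cokernel C q f" "f \<in> Hom C X Y" "x \<in> Hom C Y W" "x \<cdot> f = MZero C X W"
  obtains u where "u \<in> Hom C (Cod C q) W" "u \<cdot> q = x"
proof -
  have "W \<in> Obj C" "Dom C f = X" "Cod C f = Y" using assms Hom_Obj by (auto simp: Hom_iff)
  then show ?thesis using that assms unfolding is_cokernel_def by metis
qed

text \<open>The uniqueness clause of \<open>is_kernel\<close>, applied to the zero map: an
  \<open>x\<close> killed by \<open>k\<close> and the zero morphism both factor it.\<close>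

lemma kernel_monic:
  assumes "is_kernel C k f"
  shows "monic C k"
proof -
  have f: "f \<in> Hom C (Dom C f) (Cod C f)" using assms by (simp add: is_kernel_def Hom_iff)
  note k = kernel_Hom[OF assms f]
  show ?thesis
  proof (rule monicI_zero[OF k(1)])
    fix X x assume x: "x \<in> Hom C X (Dom C k)" "k \<cdot> x = MZero C X (Dom C f)"
    have X: "X \<in> Obj C" "Dom C k \<in> Obj C" "Dom C f \<in> Obj C" using x k Hom_Obj by auto
    let ?z = "MZero C X (Dom C f)"
    have "\<exists>!u. u \<in> Hom C X (Dom C k) \<and> k \<cdot> u = ?z"
      using assms X Comp_MZero(1)[OF f X(1)] MZero_Hom[OF X(1,3)] unfolding is_kernel_def by blast
    moreover have "k \<cdot> MZero C X (Dom C k) = ?z" using Comp_MZero(1)[OF k(1) X(1)] .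
    ultimately show "x = MZero C X (Dom C k)" using x MZero_Hom[OF X(1,2)] by blast
  qed
qed

lemma cokernel_epic:
  assumes "is_cokernel C q f"
  shows "epic C q"
proof -
  have f: "f \<in> Hom C (Dom C f) (Cod C f)" using assms by (simp add: is_cokernel_def Hom_iff)
  note q = cokernel_Hom[OF assms f]
  show ?thesis
  proof (rule epicI_zero[OF q(1)])
    fix X x assume x: "x \<in> Hom C (Cod C q) X" "x \<cdot> q = MZero C (Cod C f) X"
    have X: "X \<in> Obj C" "Cod C q \<in> Obj C" "Cod C f \<in> Obj C" using x q Hom_Obj by auto
    let ?z = "MZero C (Cod C f) X"
    have "\<exists>!u. u \<in> Hom C (Cod C q) X \<and> u \<cdot> q = ?z"
      using assms X Comp_MZero(2)[OF f X(1)] MZero_Hom[OF X(3,1)] unfolding is_cokernel_def by blast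
    moreover have "MZero C (Cod C q) X \<cdot> q = ?z" using Comp_MZero(2)[OF q(1) X(1)] .
    ultimately show "x = MZero C (Cod C q) X" using x MZero_Hom[OF X(2,1)] by blast
  qed
qed

text \<open>Monicity of \<open>k\<close> takes care of uniqueness, which leaves the existence of
  factorizations.\<close>

lemma is_kernelI:
  assumes "monic C k" "k \<in> Hom C K X" "f \<in> Hom C X Y" "f \<cdot> k = MZero C K Y"
    and "\<And>W x. x \<in> Hom C W X \<Longrightarrow> f \<cdot> x = MZero C W Y \<Longrightarrow> \<exists>u\<in>Hom C W K. k \<cdot> u = x"
  shows "is_kernel C k f"
proof -
  have D: "f \<in> Arr C" "Dom C f = X" "Cod C f = Y" "Dom C k = K" using assms by (auto simp: Hom_iff)
  show ?thesis unfolding is_kernel_def D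
    using D(1) assms monic_cancel[OF assms(1)] by (auto simp: D)
qed

lemma is_cokernelI:
  assumes "epic C q" "q \<in> Hom C Y Q" "f \<in> Hom C X Y" "q \<cdot> f = MZero C X Q"
    and "\<And>W x. x \<in> Hom C Y W \<Longrightarrow> x \<cdot> f = MZero C X W \<Longrightarrow> \<exists>u\<in>Hom C Q W. u \<cdot> q = x"
  shows "is_cokernel C q f"
proof -
  have D: "f \<in> Arr C" "Dom C f = X" "Cod C f = Y" "Cod C q = Q" using assms by (auto simp: Hom_iff)
  show ?thesis unfolding is_cokernel_def D
    using D(1) assms epic_cancel[OF assms(1)] by (auto simp: D)
qed

end

section \<open>Images, intersections and pullbacks in an abelian category\<close>

context abelian_category
begin

text \<open>Composites are bracketed to the right, where the left side \<open>g \<cdot> f\<close> of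
  a known equation is no longer a subterm; this recovers the rewriting step.\<close>

lemma Comp_eq_extend:
  assumes "g \<cdot> f = k" "x \<in> Hom C W X" "f \<in> Hom C X Y" "g \<in> Hom C Y Z"
  shows "g \<cdot> f \<cdot> x = k \<cdot> x"
  using assms Comp_assoc by metis

text \<open>The axiom only makes \<open>m\<close> the kernel of some \<open>f\<close>. Since
  \<open>f\<close> kills \<open>m\<close>, it factors through \<open>c\<close>; hence whatever
  \<open>c\<close> kills is killed by \<open>f\<close> and factors through \<open>m\<close>.\<close>

lemma monic_kernel_of_cokernel:
  assumes m: "monic C m" "m \<in> Hom C X Y" and c: "is_cokernel C c m"
  shows "is_kernel C m c"
proof -
  note c' = cokernel_Hom[OF c m(2)]
  obtain f where f: "is_kernel C m f" using monic_is_kernel[OF m(1)] by blast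
  then have "f \<in> Hom C Y (Cod C f)" using m(2) by (auto simp: is_kernel_def Hom_iff)
  note f' = this kernel_Hom(2)[OF f this]
  have "f \<cdot> m = MZero C X (Cod C f)" using f'(2) m(2) by (simp add: Hom_iff)
  then obtain v where v: "v \<in> Hom C (Cod C c) (Cod C f)" "v \<cdot> c = f"
    using cokernel_factor[OF c m(2) f'(1)] by blast
  show ?thesis
  proof (rule is_kernelI[OF m c'])
    fix W x assume x: "x \<in> Hom C W Y" "c \<cdot> x = MZero C W (Cod C c)"
    have "f \<cdot> x = v \<cdot> c \<cdot> x" using Comp_eq_extend[OF v(2) x(1) c'(1) v(1)] by simp
    also have "\<dots> = MZero C W (Cod C f)" using x Comp_MZero(1)[OF v(1)] Hom_Obj[OF x(1)] by simp
    finally obtain u where "u \<in> Hom C W (Dom C m)" "m \<cdot> u = x"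
      using kernel_factor[OF f f'(1) x(1)] by blast
    then show "\<exists>u\<in>Hom C W X. m \<cdot> u = x" using m(2) by (auto simp: Hom_iff)
  qed
qed

text \<open>Dually, \<open>e\<close> is the cokernel of some \<open>f\<close>, and \<open>f\<close>
  factors through \<open>k\<close>; hence whatever kills \<open>k\<close> kills \<open>f\<close> and
  factors through \<open>e\<close>.\<close>

lemma epic_cokernel_of_kernel:
  assumes e: "epic C e" "e \<in> Hom C X Y" and k: "is_kernel C k e"
  shows "is_cokernel C e k"
proof -
  note k' = kernel_Hom[OF k e(2)]
  obtain f where f: "is_cokernel C e f" using epic_is_cokernel[OF e(1)] by blast
  then have "f \<in> Hom C (Dom C f) X" using e(2) by (auto simp: is_cokernel_def Hom_iff)
  note f' = this cokernel_Hom(2)[OF f this]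
  have "e \<cdot> f = MZero C (Dom C f) Y" using f'(2) e(2) by (simp add: Hom_iff)
  then obtain v where v: "v \<in> Hom C (Dom C f) (Dom C k)" "k \<cdot> v = f"
    using kernel_factor[OF k e(2) f'(1)] by blast
  show ?thesis
  proof (rule is_cokernelI[OF e k'])
    fix W x assume x: "x \<in> Hom C X W" "x \<cdot> k = MZero C (Dom C k) W"
    have "x \<cdot> f = (x \<cdot> k) \<cdot> v" using v(2) Comp_assoc[OF v(1) k'(1) x(1)] by simp
    also have "\<dots> = MZero C (Dom C f) W" using x Comp_MZero(2)[OF v(1)] Hom_Obj[OF x(1)] by simp
    finally obtain u where "u \<in> Hom C (Cod C e) W" "u \<cdot> e = x"
      using cokernel_factor[OF f f'(1) x(1)] by blast
    then show "\<exists>u\<in>Hom C Y W. u \<cdot> e = x" using e(2) by (auto simp: Hom_iff)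
  qed
qed

text \<open>The cokernel \<open>c\<close> of an epic is zero, so the identity of Y is killed by
  \<open>c\<close> and factors through \<open>f\<close>, the kernel of \<open>c\<close>. This right
  inverse is two-sided because \<open>f\<close> can be cancelled.\<close>

lemma monic_epic_isomorphism:
  assumes "monic C f" "epic C f"
  shows "isomorphism C f"
proof -
  obtain X Y where f: "f \<in> Hom C X Y" using monic_arrow assms(1) by (auto simp: Hom_iff)
  have Y: "Y \<in> Obj C" using Hom_Obj f by auto
  obtain c where c: "is_cokernel C c f" using cokernel_exists monic_arrow assms(1) by blast
  note c' = cokernel_Hom[OF c f]
  have "c \<cdot> Ident C Y = MZero C Y (Cod C c)"
    using epic_zeroD[OF assms(2) f c'] Comp_Ident_right[OF c'(1)] by simp
  then obtain u where "u \<in> Hom C Y (Dom C f)" and fu: "f \<cdot> u = Ident C Y"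
    using kernel_factor[OF monic_kernel_of_cokernel[OF assms(1) f c] c'(1) Ident_Hom[OF Y]] by blast
  then have u: "u \<in> Hom C Y X" using f by (simp add: Hom_iff)
  have "f \<cdot> u \<cdot> f = f \<cdot> Ident C X"
    using Comp_eq_extend[OF fu f u f] f Comp_Ident_left Comp_Ident_right by simp
  then have "u \<cdot> f = Ident C X"
    by (rule monic_cancel_Hom[OF _ assms(1) f Comp_Hom[OF f u] Ident_Hom[OF Hom_Obj(1)[OF f]]])
  then show ?thesis unfolding isomorphism_def using f u fu by (auto simp: Hom_iff)
qed

text \<open>The monic part is the kernel of the cokernel \<open>c\<close>.  If \<open>a \<cdot> e = 0\<close>, then \<open>f\<close> factors through
  \<open>m \<cdot> ker a\<close>, whose cokernel \<open>d\<close> therefore factors through \<open>c\<close>; hence \<open>d \<cdot> m = 0\<close>, and \<open>ker a\<close> is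
  split epic.\<close>
lemma image_factorization:
  assumes f: "f \<in> Hom C X Y" and c: "is_cokernel C c f" and m: "is_kernel C m c"
  obtains e where "e \<in> Hom C X (Dom C m)" "epic C e" "m \<cdot> e = f"
proof -
  note c' = cokernel_Hom[OF c f]
  note m' = kernel_Hom[OF m c'(1)] kernel_monic[OF m]
  let ?I = "Dom C m"
  obtain e where e: "e \<in> Hom C X ?I" "m \<cdot> e = f" using kernel_factor[OF m c'(1) f c'(2)] .
  have "epic C e"
  proof (rule epicI_zero[OF e(1)])
    fix Z a assume a: "a \<in> Hom C ?I Z" "a \<cdot> e = MZero C X Z"
    obtain k where k: "is_kernel C k a" using kernel_exists a by (auto simp: Hom_iff)
    note k' = kernel_Hom[OF k a(1)] kernel_monic[OF k]
    let ?K = "Dom C k"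
    obtain u where u: "u \<in> Hom C X ?K" "k \<cdot> u = e" using kernel_factor[OF k a(1) e(1) a(2)] .
    have mk: "m \<cdot> k \<in> Hom C ?K Y" using k'(1) m'(1) by (rule Comp_Hom)
    have mk_mono: "monic C (m \<cdot> k)" using monic_Comp[OF m'(3) k'(3)] k'(1) by (simp add: Hom_iff)
    obtain d where d: "is_cokernel C d (m \<cdot> k)" using cokernel_exists mk by (auto simp: Hom_iff)
    note d' = cokernel_Hom[OF d mk]
    have "(m \<cdot> k) \<cdot> u = f" using u e m'(1) k'(1) by (simp add: Hom_iff)
    then have "d \<cdot> f = (d \<cdot> m \<cdot> k) \<cdot> u" using Comp_assoc[OF u(1) mk d'(1)] by simp
    also have "\<dots> = MZero C X (Cod C d)"
      using d'(2) Comp_MZero(2)[OF u(1)] Hom_Obj[OF d'(1)] by simp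
    finally obtain w where w: "w \<in> Hom C (Cod C c) (Cod C d)" "w \<cdot> c = d"
      using cokernel_factor[OF c f d'(1)] by blast
    have "d \<cdot> m = w \<cdot> c \<cdot> m" using Comp_eq_extend[OF w(2) m'(1) c'(1) w(1)] by simp
    also have "\<dots> = MZero C ?I (Cod C d)"
      using m'(2) Comp_MZero(1)[OF w(1)] Hom_Obj[OF m'(1)] by simp
    finally obtain s where "s \<in> Hom C ?I (Dom C (m \<cdot> k))" and ms: "(m \<cdot> k) \<cdot> s = m"
      using kernel_factor[OF monic_kernel_of_cokernel[OF mk_mono mk d] d'(1) m'(1)] by blast
    then have s: "s \<in> Hom C ?I ?K" using mk by (simp add: Hom_iff)
    have I: "?I \<in> Obj C" using Hom_Obj e(1) by auto
    have "m \<cdot> k \<cdot> s = m \<cdot> Ident C ?I"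
      using ms Comp_assoc[OF s k'(1) m'(1)] Comp_Ident_right[OF m'(1)] by simp
    then have ks: "k \<cdot> s = Ident C ?I"
      using monic_cancel[OF m'(3) Comp_Hom[OF s k'(1)] Ident_Hom[OF I]] by blast
    have "a = (a \<cdot> k) \<cdot> s" using ks Comp_Ident_right[OF a(1)] Comp_assoc[OF s k'(1) a(1)] by simp
    also have "\<dots> = MZero C ?I Z" using k'(2) Comp_MZero(2)[OF s] Hom_Obj[OF a(1)] by simp
    finally show "a = MZero C ?I Z" .
  qed
  then show ?thesis using that e by blast
qed

lemma epic_monic_factorization:
  assumes "f \<in> Hom C X Y"
  obtains I e m where "e \<in> Hom C X I" "epic C e" "m \<in> Hom C I Y" "monic C m" "m \<cdot> e = f"
proof -
  obtain c where c: "is_cokernel C c f" using cokernel_exists assms by (auto simp: Hom_iff)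
  note c' = cokernel_Hom[OF c assms]
  obtain m where m: "is_kernel C m c" using kernel_exists c' by (auto simp: Hom_iff)
  show ?thesis
    using image_factorization[OF assms c m] that kernel_monic[OF m] kernel_Hom(1)[OF m c'(1)] by metis
qed

text \<open>The intersection is the kernel of Y \<rightarrow> M \<rightarrow> M/X. Both inclusions
  \<open>x\<close> and \<open>y\<close> are returned, because later arguments use W as a subobject
  of X and of Y.\<close>

lemma intersection_exists:
  assumes m: "monic C m" "m \<in> Hom C X M" and s: "monic C s" "s \<in> Hom C Y M"
  obtains W x y where "x \<in> Hom C W X" "y \<in> Hom C W Y" "monic C x" "monic C y" "m \<cdot> x = s \<cdot> y"
    "is_sub_inter C M m s (s \<cdot> y)"
proof -
  obtain c where c: "is_cokernel C c m" using cokernel_exists m by (auto simp: Hom_iff)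
  note c' = cokernel_Hom[OF c m(2)]
  note mc = monic_kernel_of_cokernel[OF m c]
  have cs: "c \<cdot> s \<in> Hom C Y (Cod C c)" using s(2) c'(1) by (rule Comp_Hom)
  obtain y where y: "is_kernel C y (c \<cdot> s)" using kernel_exists cs by (auto simp: Hom_iff)
  note y' = kernel_Hom[OF y cs] kernel_monic[OF y]
  let ?W = "Dom C y"
  have sy: "s \<cdot> y \<in> Hom C ?W M" using y'(1) s(2) by (rule Comp_Hom)
  have sy_mono: "monic C (s \<cdot> y)" using monic_Comp[OF s(1) y'(3)] y'(1) s(2) by (simp add: Hom_iff)
  have "c \<cdot> s \<cdot> y = MZero C ?W (Cod C c)" using y'(2) Comp_assoc[OF y'(1) s(2) c'(1)] by simp
  then obtain x where "x \<in> Hom C ?W (Dom C m)" and mx: "m \<cdot> x = s \<cdot> y"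
    using kernel_factor[OF mc c'(1) sy] by blast
  then have x: "x \<in> Hom C ?W X" using m(2) by (simp add: Hom_iff)
  have "is_sub_inter C M m s (s \<cdot> y)"
    unfolding is_sub_inter_def
  proof (intro conjI allI impI)
    show "subobject C M (s \<cdot> y)" using sy_mono sy by (simp add: subobject_def Hom_iff)
    show "sub_le C (s \<cdot> y) m" unfolding sub_le_def using mx x m(2) sy by (auto simp: Hom_iff)
    show "sub_le C (s \<cdot> y) s" unfolding sub_le_def using y'(1) s(2) sy by (auto simp: Hom_iff)
    fix t assume "subobject C M t \<and> sub_le C t m \<and> sub_le C t s"
    then obtain a b where a: "a \<in> Hom C (Dom C t) (Dom C m)" "m \<cdot> a = t"
      and b: "b \<in> Hom C (Dom C t) (Dom C s)" "s \<cdot> b = t"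
      unfolding sub_le_def by blast
    have a1: "a \<in> Hom C (Dom C t) X" and b1: "b \<in> Hom C (Dom C t) Y"
      using a b m s by (auto simp: Hom_iff)
    have "(c \<cdot> s) \<cdot> b = c \<cdot> m \<cdot> a" using Comp_assoc[OF b1 s(2) c'(1)] a(2) b(2) by simp
    also have "\<dots> = MZero C (Dom C t) (Cod C c)"
      using Comp_eq_extend[OF c'(2) a1 m(2) c'(1)] Comp_MZero(2)[OF a1] Hom_Obj[OF c'(1)] by simp
    finally obtain u where u: "u \<in> Hom C (Dom C t) ?W" "y \<cdot> u = b"
      using kernel_factor[OF y cs b1] by blast
    then have "(s \<cdot> y) \<cdot> u = t" using Comp_assoc[OF u(1) y'(1) s(2)] b(2) by simp
    then show "sub_le C t (s \<cdot> y)" unfolding sub_le_def using u sy by (auto simp: Hom_iff)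
  qed
  moreover have "monic C x" using monic_right_factor[OF _ x m(2)] sy_mono mx by simp
  ultimately show ?thesis using that[OF x y'(1) _ y'(3) mx] by blast
qed

text \<open>P is the preimage of L, the kernel of M \<rightarrow> Q \<rightarrow> Q/L. To see that
  \<open>r\<close> is epic, let I be its image and \<open>d\<close> the cokernel of I \<rightarrow>
  Q. Then \<open>d \<cdot> p\<close> kills \<open>k\<close>, so it factors through
  \<open>c \<cdot> p\<close>, the cokernel of \<open>k\<close>. Cancelling \<open>p\<close> shows
  that \<open>d\<close> factors through \<open>c\<close>, so \<open>d\<close> kills L, and the
  inclusion of I in L is split epic.\<close>

lemma epic_pullback:
  assumes p: "epic C p" "p \<in> Hom C M Q" and l: "monic C l" "l \<in> Hom C L Q"
  obtains P k r where "k \<in> Hom C P M" "monic C k" "r \<in> Hom C P L" "epic C r" "p \<cdot> k = l \<cdot> r"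
proof -
  obtain c where c: "is_cokernel C c l" using cokernel_exists l by (auto simp: Hom_iff)
  note c' = cokernel_Hom[OF c l(2)]
  let ?R = "Cod C c"
  note lc = monic_kernel_of_cokernel[OF l c]
  have cp: "c \<cdot> p \<in> Hom C M ?R" using p(2) c'(1) by (rule Comp_Hom)
  have cp_epic: "epic C (c \<cdot> p)"
    using epic_Comp[OF cokernel_epic[OF c] p(1)] c'(1) p(2) by (simp add: Hom_iff)
  obtain k where k: "is_kernel C k (c \<cdot> p)" using kernel_exists cp by (auto simp: Hom_iff)
  note k' = kernel_Hom[OF k cp] kernel_monic[OF k]
  let ?P = "Dom C k"
  have pk: "p \<cdot> k \<in> Hom C ?P Q" using k'(1) p(2) by (rule Comp_Hom)
  have "c \<cdot> p \<cdot> k = MZero C ?P ?R" using k'(2) Comp_assoc[OF k'(1) p(2) c'(1)] by simp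
  then obtain r where "r \<in> Hom C ?P (Dom C l)" and lr: "l \<cdot> r = p \<cdot> k"
    using kernel_factor[OF lc c'(1) pk] by blast
  then have r: "r \<in> Hom C ?P L" using l(2) by (simp add: Hom_iff)
  obtain I e m where e: "e \<in> Hom C ?P I" "epic C e" and m: "m \<in> Hom C I L" "monic C m"
    and me: "m \<cdot> e = r" using epic_monic_factorization[OF r] .
  have lm: "l \<cdot> m \<in> Hom C I Q" using m(1) l(2) by (rule Comp_Hom)
  have lm_mono: "monic C (l \<cdot> m)" using monic_Comp[OF l(1) m(2)] m(1) l(2) by (simp add: Hom_iff)
  obtain d where d: "is_cokernel C d (l \<cdot> m)" using cokernel_exists lm by (auto simp: Hom_iff)
  note d' = cokernel_Hom[OF d lm]
  have dp: "d \<cdot> p \<in> Hom C M (Cod C d)" using p(2) d'(1) by (rule Comp_Hom)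
  have "p \<cdot> k = (l \<cdot> m) \<cdot> e" using lr me Comp_assoc[OF e(1) m(1) l(2)] by simp
  then have "(d \<cdot> p) \<cdot> k = d \<cdot> (l \<cdot> m) \<cdot> e"
    using Comp_assoc[OF k'(1) p(2) d'(1)] by simp
  also have "\<dots> = MZero C ?P (Cod C d)"
    using Comp_eq_extend[OF d'(2) e(1) lm d'(1)] Comp_MZero(2)[OF e(1)] Hom_Obj[OF d'(1)] by simp
  finally obtain v where "v \<in> Hom C (Cod C (c \<cdot> p)) (Cod C d)" and v': "v \<cdot> c \<cdot> p = d \<cdot> p"
    using cokernel_factor[OF epic_cokernel_of_kernel[OF cp_epic cp k] k'(1) dp] by blast
  then have v: "v \<in> Hom C ?R (Cod C d)" using cp by (simp add: Hom_iff)
  have "(v \<cdot> c) \<cdot> p = d \<cdot> p" using v' Comp_assoc[OF p(2) c'(1) v] by simp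
  then have "v \<cdot> c = d"
    by (rule epic_cancel_Hom[OF _ p Comp_Hom[OF c'(1) v] d'(1)])
  then have "d \<cdot> l = v \<cdot> c \<cdot> l" using Comp_eq_extend[OF _ l(2) c'(1) v] by simp
  also have "\<dots> = MZero C L (Cod C d)"
    using c'(2) Comp_MZero(1)[OF v] Hom_Obj[OF l(2)] by simp
  finally obtain w where "w \<in> Hom C L (Dom C (l \<cdot> m))" and lw: "(l \<cdot> m) \<cdot> w = l"
    using kernel_factor[OF monic_kernel_of_cokernel[OF lm_mono lm d] d'(1) l(2)] by blast
  then have w: "w \<in> Hom C L I" using lm by (simp add: Hom_iff)
  have L: "L \<in> Obj C" using Hom_Obj l(2) by auto
  have "l \<cdot> m \<cdot> w = l \<cdot> Ident C L"
    using lw Comp_assoc[OF w m(1) l(2)] Comp_Ident_right[OF l(2)] by simp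
  then have "m \<cdot> w = Ident C L"
    by (rule monic_cancel_Hom[OF _ l Comp_Hom[OF w m(1)] Ident_Hom[OF L]])
  then have "epic C m" using epic_left_factor[OF _ w m(1)] epic_Ident[OF L] by simp
  then have "epic C r" using epic_Comp[OF _ e(2)] me e(1) m(1) by (auto simp: Hom_iff)
  then show ?thesis using that[OF k'(1,3) r] lr by simp
qed

section \<open>Subquotients and monoform objects\<close>

lemma monic_subquotient:
  assumes "monic C m" "m \<in> Hom C X M"
  shows "subquotient C X M"
  using assms epic_Ident[of X] Hom_Obj(1)[OF assms(2)] unfolding subquotient_def subobject_def
  by (intro exI[of _ m] exI[of _ "Ident C X"]) (simp add: Hom_iff)

text \<open>A subobject of Q is replaced by its preimage in M, which maps onto it by
  \<open>epic_pullback\<close>.\<close>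

lemma subquotient_of_quotient:
  assumes p: "epic C p" "p \<in> Hom C M Q" and K: "subquotient C K Q"
  shows "subquotient C K M"
proof -
  obtain s q where s: "monic C s" "s \<in> Hom C (Dom C s) Q" and q: "epic C q" "q \<in> Hom C (Dom C s) K"
    using K monic_arrow epic_arrow unfolding subquotient_def subobject_def by (auto simp: Hom_iff)
  obtain P k r where k: "k \<in> Hom C P M" "monic C k" and r: "r \<in> Hom C P (Dom C s)" "epic C r"
    by (rule epic_pullback[OF p s])
  have "epic C (q \<cdot> r)" using epic_Comp[OF q(1) r(2)] q(2) r(1) by (simp add: Hom_iff)
  then show ?thesis
    using k q(2) r(1) unfolding subquotient_def subobject_def
    by (intro exI[of _ k] exI[of _ "q \<cdot> r"]) (simp add: Hom_iff)
qed

text \<open>The isomorphism between two subobjects is absorbed into one of the monics, which leaves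
  a single object W embedded on both sides. Arguments then never have to carry an isomorphism
  along.\<close>

lemma monoform_iff:
  "monoform C H \<longleftrightarrow> H \<in> Obj C \<and> \<not> zero_object C H \<and>
     (\<forall>n q W s t. nonzero_subobject C H n \<and> is_cokernel C q n \<and> s \<in> Hom C W H \<and> monic C s \<and>
        t \<in> Hom C W (Cod C q) \<and> monic C t \<longrightarrow> zero_object C W)"
  (is "_ \<longleftrightarrow> _ \<and> _ \<and> ?P")
proof -
  have "(\<exists>s t. nonzero_subobject C H s \<and> subobject C Q t \<and> isomorphic C (Dom C s) (Dom C t)) \<longleftrightarrow>
    (\<exists>W s t. s \<in> Hom C W H \<and> monic C s \<and> t \<in> Hom C W Q \<and> monic C t \<and> \<not> zero_object C W)"
    (is "?L \<longleftrightarrow> ?R") for Q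
  proof
    assume ?L
    then obtain s t f where "nonzero_subobject C H s" "subobject C Q t"
      "f \<in> Hom C (Dom C s) (Dom C t)" "isomorphism C f"
      unfolding isomorphic_def by blast
    then have "s \<in> Hom C (Dom C s) H \<and> monic C s \<and> t \<cdot> f \<in> Hom C (Dom C s) Q \<and> monic C (t \<cdot> f) \<and>
      \<not> zero_object C (Dom C s)"
      using monic_Comp isomorphism_monic monic_arrow
      by (auto simp: nonzero_subobject_def subobject_def Hom_iff)
    then show ?R by blast
  next
    assume ?R
    then show ?L
      unfolding nonzero_subobject_def subobject_def
      by (metis (no_types, lifting) Hom_Obj(1) Hom_iff isomorphic_refl)
  qed
  then show ?thesis unfolding monoform_def by blast
qed

lemma atom_rel_iff:
  "(H, K) \<in> atom_rel C \<longleftrightarrow> monoform C H \<and> monoform C K \<and>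
     (\<exists>W s t. \<not> zero_object C W \<and> s \<in> Hom C W H \<and> monic C s \<and> t \<in> Hom C W K \<and> monic C t)"
proof -
  have "(\<exists>s t. nonzero_subobject C H s \<and> nonzero_subobject C K t \<and> isomorphic C (Dom C s) (Dom C t))
    \<longleftrightarrow> (\<exists>W s t. \<not> zero_object C W \<and> s \<in> Hom C W H \<and> monic C s \<and> t \<in> Hom C W K \<and> monic C t)"
    (is "?L \<longleftrightarrow> ?R")
  proof
    assume ?L
    then obtain s t f where "nonzero_subobject C H s" "nonzero_subobject C K t"
      "f \<in> Hom C (Dom C s) (Dom C t)" "isomorphism C f"
      unfolding isomorphic_def by blast
    then have "\<not> zero_object C (Dom C s) \<and> s \<in> Hom C (Dom C s) H \<and> monic C s \<and>
      t \<cdot> f \<in> Hom C (Dom C s) K \<and> monic C (t \<cdot> f)"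
      using monic_Comp isomorphism_monic monic_arrow
      by (auto simp: nonzero_subobject_def subobject_def Hom_iff)
    then show ?R by blast
  next
    assume ?R
    then show ?L
      unfolding nonzero_subobject_def subobject_def
      by (metis (no_types, lifting) Hom_Obj(1) Hom_iff isomorphic_refl)
  qed
  then show ?thesis unfolding atom_rel_def by blast
qed

lemma monic_if_kernel_zero:
  assumes f: "f \<in> Hom C X Y" and k: "is_kernel C k f" and "zero_object C (Dom C k)"
  shows "monic C f"
proof (rule monicI_zero[OF f])
  fix W x assume x: "x \<in> Hom C W X" "f \<cdot> x = MZero C W Y"
  obtain u where u: "u \<in> Hom C W (Dom C k)" "k \<cdot> u = x" using kernel_factor[OF k f x] .
  then have "u = MZero C W (Dom C k)" using zero_object_Hom(2) assms(3) by blast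
  then show "x = MZero C W X"
    using u(2) Comp_MZero(1)[OF kernel_Hom(1)[OF k f]] Hom_Obj[OF x(1)] by blast
qed

lemma monoformD:
  assumes "monoform C H" "n \<in> Hom C N H" "monic C n" "is_cokernel C q n"
    "s \<in> Hom C W H" "monic C s" "t \<in> Hom C W (Cod C q)" "monic C t" "\<not> zero_object C N"
  shows "zero_object C W"
proof -
  have "nonzero_subobject C H n"
    using assms by (simp add: nonzero_subobject_def subobject_def Hom_iff)
  then show ?thesis using assms unfolding monoform_iff by blast
qed

text \<open>For N \<subseteq> S \<subseteq> H, the induced map \<open>v\<close> from S/N to H/N is
  monic, so an object violating the condition for S violates it for H. To see that the kernel Z of
  \<open>v\<close> vanishes, take its preimage P in S: it dies in H/N, hence lies in N, hence maps
  to zero in S/N; but P maps onto Z.\<close>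

lemma monoform_nonzero_subobject:
  assumes H: "monoform C H" and s: "monic C s" "s \<in> Hom C S H" and S: "\<not> zero_object C S"
  shows "monoform C S"
  unfolding monoform_iff
proof (intro conjI allI impI)
  show "S \<in> Obj C" "\<not> zero_object C S" using Hom_Obj s S by auto
  fix n q W w t
  assume *: "nonzero_subobject C S n \<and> is_cokernel C q n \<and> w \<in> Hom C W S \<and> monic C w \<and>
    t \<in> Hom C W (Cod C q) \<and> monic C t"
  let ?N = "Dom C n"
  let ?Q = "Cod C q"
  have n: "n \<in> Hom C ?N S" "monic C n" "\<not> zero_object C ?N"
    using * monic_arrow by (auto simp: nonzero_subobject_def subobject_def Hom_iff)
  have q: "is_cokernel C q n" using * by blast
  note q' = cokernel_Hom[OF q n(1)]
  have sn: "s \<cdot> n \<in> Hom C ?N H" using n(1) s(2) by (rule Comp_Hom)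
  have sn_mono: "monic C (s \<cdot> n)" using monic_Comp[OF s(1) n(2)] n s by (simp add: Hom_iff)
  obtain d where d: "is_cokernel C d (s \<cdot> n)" using cokernel_exists sn by (auto simp: Hom_iff)
  note d' = cokernel_Hom[OF d sn]
  have ds: "d \<cdot> s \<in> Hom C S (Cod C d)" using s(2) d'(1) by (rule Comp_Hom)
  have "(d \<cdot> s) \<cdot> n = MZero C ?N (Cod C d)" using d'(2) Comp_assoc[OF n(1) s(2) d'(1)] by simp
  then obtain v where v: "v \<in> Hom C ?Q (Cod C d)" "v \<cdot> q = d \<cdot> s"
    using cokernel_factor[OF q n(1) ds] by blast
  obtain z where z: "is_kernel C z v" using kernel_exists v by (auto simp: Hom_iff)
  note z' = kernel_Hom[OF z v(1)] kernel_monic[OF z]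
  obtain P k r where k: "k \<in> Hom C P S" "monic C k" and r: "r \<in> Hom C P (Dom C z)" "epic C r"
    and qk: "q \<cdot> k = z \<cdot> r"
    using epic_pullback[OF cokernel_epic[OF q] q'(1) z'(3,1)] .
  have sk: "s \<cdot> k \<in> Hom C P H" using k(1) s(2) by (rule Comp_Hom)
  have P: "P \<in> Obj C" using Hom_Obj(1)[OF k(1)] .
  have "d \<cdot> s \<cdot> k = (v \<cdot> q) \<cdot> k" using v(2) Comp_assoc[OF k(1) s(2) d'(1)] by simp
  also have "\<dots> = v \<cdot> z \<cdot> r" using qk Comp_assoc[OF k(1) q'(1) v(1)] by simp
  also have "\<dots> = MZero C P (Cod C d)"
    using Comp_eq_extend[OF z'(2) r(1) z'(1) v(1)] Comp_MZero(2)[OF r(1)] Hom_Obj[OF v(1)] by simp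
  finally obtain u where "u \<in> Hom C P (Dom C (s \<cdot> n))" and snu: "(s \<cdot> n) \<cdot> u = s \<cdot> k"
    using kernel_factor[OF monic_kernel_of_cokernel[OF sn_mono sn d] d'(1) sk] by blast
  then have u: "u \<in> Hom C P ?N" using sn by (simp add: Hom_iff)
  have "s \<cdot> n \<cdot> u = s \<cdot> k" using snu Comp_assoc[OF u n(1) s(2)] by simp
  then have "n \<cdot> u = k" by (rule monic_cancel_Hom[OF _ s Comp_Hom[OF u n(1)] k(1)])
  then have "z \<cdot> r = q \<cdot> n \<cdot> u" using qk by simp
  also have "\<dots> = MZero C P ?Q"
    using Comp_eq_extend[OF q'(2) u n(1) q'(1)] Comp_MZero(2)[OF u] Hom_Obj[OF q'(1)] by simp
  finally have "z = MZero C (Dom C z) ?Q" by (rule epic_zeroD[OF r(2,1) z'(1)])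
  then have "zero_object C (Dom C z)" using zero_monic z' by blast
  then have "monic C v" using monic_if_kernel_zero v(1) z by blast
  then have "monic C (v \<cdot> t)" "v \<cdot> t \<in> Hom C W (Cod C d)"
    using monic_Comp[of v t] * v(1) by (auto simp: Hom_iff)
  moreover have "monic C (s \<cdot> w)" "s \<cdot> w \<in> Hom C W H"
    using monic_Comp[OF s(1), of w] * s(2) by (auto simp: Hom_iff)
  ultimately show "zero_object C W"
    using monoformD[OF H sn sn_mono d] n(3) by blast
qed

end

section \<open>Uniform objects\<close>

text \<open>A nonzero W with a commuting square stands in for a nonzero intersection. In this form
  the property is transported along monics by composing and cancelling, with no intersection to
  recompute.\<close>

definition uniform_object :: "('o, 'm, 'x) additive_data_scheme \<Rightarrow> 'o \<Rightarrow> bool" where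
  "uniform_object C M \<longleftrightarrow>
     (\<forall>X Y s t. s \<in> Hom C X M \<and> monic C s \<and> \<not> zero_object C X \<and>
        t \<in> Hom C Y M \<and> monic C t \<and> \<not> zero_object C Y \<longrightarrow>
        (\<exists>W x y. \<not> zero_object C W \<and> x \<in> Hom C W X \<and> monic C x \<and> y \<in> Hom C W Y \<and> monic C y \<and>
           Comp C s x = Comp C t y))"

context abelian_category
begin

lemma uniform_objectE:
  assumes "uniform_object C M" "s \<in> Hom C X M" "monic C s" "\<not> zero_object C X"
    "t \<in> Hom C Y M" "monic C t" "\<not> zero_object C Y"
  obtains W x y where "\<not> zero_object C W" "x \<in> Hom C W X" "monic C x" "y \<in> Hom C W Y" "monic C y"
    "s \<cdot> x = t \<cdot> y"
  using assms unfolding uniform_object_def by meson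

text \<open>If X and Y met in zero, then Y \<rightarrow> H/X would be monic, as its kernel lies in
  both X and Y. The nonzero Y would then embed both in H and in H/X.\<close>

lemma monoform_uniform:
  assumes H: "monoform C H"
  shows "uniform_object C H"
  unfolding uniform_object_def
proof (intro allI impI)
  fix X Y s t
  assume *: "s \<in> Hom C X H \<and> monic C s \<and> \<not> zero_object C X \<and>
    t \<in> Hom C Y H \<and> monic C t \<and> \<not> zero_object C Y"
  then have s: "s \<in> Hom C X H" "monic C s" and t: "t \<in> Hom C Y H" "monic C t" by auto
  obtain W x y where x: "x \<in> Hom C W X" "monic C x" and y: "y \<in> Hom C W Y" "monic C y"
    and eq: "s \<cdot> x = t \<cdot> y" and inter: "is_sub_inter C H s t (t \<cdot> y)"
    using intersection_exists[OF s(2,1) t(2,1)] .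
  have "\<not> zero_object C W"
  proof
    assume W: "zero_object C W"
    obtain q where q: "is_cokernel C q s" using cokernel_exists s by (auto simp: Hom_iff)
    note q' = cokernel_Hom[OF q s(1)]
    have qt: "q \<cdot> t \<in> Hom C Y (Cod C q)" using t(1) q'(1) by (rule Comp_Hom)
    obtain z where z: "is_kernel C z (q \<cdot> t)" using kernel_exists qt by (auto simp: Hom_iff)
    note z' = kernel_Hom[OF z qt] kernel_monic[OF z]
    let ?Z = "Dom C z"
    have tz: "t \<cdot> z \<in> Hom C ?Z H" using z'(1) t(1) by (rule Comp_Hom)
    have tz_mono: "monic C (t \<cdot> z)" using monic_Comp[OF t(2) z'(3)] z'(1) t(1) by (simp add: Hom_iff)
    have "q \<cdot> t \<cdot> z = MZero C ?Z (Cod C q)" using z'(2) Comp_assoc[OF z'(1) t(1) q'(1)] by simp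
    then obtain u where "u \<in> Hom C ?Z (Dom C s)" "s \<cdot> u = t \<cdot> z"
      using kernel_factor[OF monic_kernel_of_cokernel[OF s(2,1) q] q'(1) tz] by blast
    then have "sub_le C (t \<cdot> z) s" unfolding sub_le_def using tz by (auto simp: Hom_iff)
    moreover have "sub_le C (t \<cdot> z) t" unfolding sub_le_def using tz z'(1) t(1) by (auto simp: Hom_iff)
    moreover have "subobject C H (t \<cdot> z)" using tz tz_mono by (simp add: subobject_def Hom_iff)
    ultimately have "sub_le C (t \<cdot> z) (t \<cdot> y)" using inter unfolding is_sub_inter_def by blast
    then obtain v where v: "v \<in> Hom C ?Z W" "(t \<cdot> y) \<cdot> v = t \<cdot> z"
      unfolding sub_le_def using tz t(1) y(1) by (auto simp: Hom_iff)
    have "monic C v"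
      using monic_right_factor[OF _ v(1) Comp_Hom[OF y(1) t(1)]] v(2) tz_mono by simp
    then have "zero_object C ?Z" using monic_into_zero v(1) W by blast
    then have "monic C (q \<cdot> t)" using monic_if_kernel_zero[OF qt z] by blast
    then show False using monoformD[OF H s q t qt] * by blast
  qed
  then show "\<exists>W x y. \<not> zero_object C W \<and> x \<in> Hom C W X \<and> monic C x \<and> y \<in> Hom C W Y \<and>
    monic C y \<and> s \<cdot> x = t \<cdot> y"
    using x y eq by blast
qed

lemma essential_monic_meets:
  assumes m: "essential_monic C m" "m \<in> Hom C X M" and s: "monic C s" "s \<in> Hom C Y M"
    and Y: "\<not> zero_object C Y"
  obtains W x y where "\<not> zero_object C W" "x \<in> Hom C W X" "monic C x" "y \<in> Hom C W Y" "monic C y"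
    "m \<cdot> x = s \<cdot> y"
proof -
  have "monic C m" using m by (simp add: essential_monic_def)
  then obtain W x y where x: "x \<in> Hom C W X" "monic C x" and y: "y \<in> Hom C W Y" "monic C y"
    and eq: "m \<cdot> x = s \<cdot> y" and inter: "is_sub_inter C M m s (s \<cdot> y)"
    using intersection_exists[OF _ m(2) s] by metis
  have "nonzero_subobject C M s"
    using s Y by (simp add: nonzero_subobject_def subobject_def Hom_iff)
  then have "\<not> zero_object C (Dom C (s \<cdot> y))"
    using m inter by (auto simp: essential_monic_def Hom_iff)
  then have "\<not> zero_object C W" using y(1) s(2) by (simp add: Hom_iff)
  then show ?thesis using that x y eq by blast
qed

text \<open>Each of X and Y contains a nonzero subobject coming from H, and inside H these two
  meet.\<close>

lemma essential_extension_uniform: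
  assumes m: "essential_monic C m" "m \<in> Hom C H E" and H: "uniform_object C H"
  shows "uniform_object C E"
  unfolding uniform_object_def
proof (intro allI impI)
  fix X Y s t
  assume *: "s \<in> Hom C X E \<and> monic C s \<and> \<not> zero_object C X \<and>
    t \<in> Hom C Y E \<and> monic C t \<and> \<not> zero_object C Y"
  then have s: "monic C s" "s \<in> Hom C X E" "\<not> zero_object C X"
    and t: "monic C t" "t \<in> Hom C Y E" "\<not> zero_object C Y" by auto
  obtain A a x where A: "\<not> zero_object C A" "a \<in> Hom C A H" "monic C a"
    and x: "x \<in> Hom C A X" "monic C x" and mx: "m \<cdot> a = s \<cdot> x"
    using essential_monic_meets[OF m s] .
  obtain B b y where B: "\<not> zero_object C B" "b \<in> Hom C B H" "monic C b"
    and y: "y \<in> Hom C B Y" "monic C y" and my: "m \<cdot> b = t \<cdot> y"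
    using essential_monic_meets[OF m t] .
  obtain W u v where W: "\<not> zero_object C W" and u: "u \<in> Hom C W A" "monic C u"
    and v: "v \<in> Hom C W B" "monic C v" and eq: "a \<cdot> u = b \<cdot> v"
    using uniform_objectE[OF H A(2,3,1) B(2,3,1)] .
  have "s \<cdot> x \<cdot> u = m \<cdot> a \<cdot> u"
    using mx Comp_assoc[OF u(1) x(1) s(2)] Comp_assoc[OF u(1) A(2) m(2)] by simp
  also have "\<dots> = t \<cdot> y \<cdot> v"
    using my eq Comp_assoc[OF v(1) y(1) t(2)] Comp_assoc[OF v(1) B(2) m(2)] by simp
  finally have "s \<cdot> x \<cdot> u = t \<cdot> y \<cdot> v" .
  moreover have "monic C (x \<cdot> u)" "monic C (y \<cdot> v)"
    using monic_Comp x y u v by (auto simp: Hom_iff)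
  ultimately show "\<exists>W x y. \<not> zero_object C W \<and> x \<in> Hom C W X \<and> monic C x \<and> y \<in> Hom C W Y \<and>
    monic C y \<and> s \<cdot> x = t \<cdot> y"
    using W Comp_Hom[OF u(1) x(1)] Comp_Hom[OF v(1) y(1)] by blast
qed

lemma uniform_subobject:
  assumes E: "uniform_object C E" and k: "monic C k" "k \<in> Hom C K E"
  shows "uniform_object C K"
  unfolding uniform_object_def
proof (intro allI impI)
  fix X Y s t
  assume *: "s \<in> Hom C X K \<and> monic C s \<and> \<not> zero_object C X \<and>
    t \<in> Hom C Y K \<and> monic C t \<and> \<not> zero_object C Y"
  then have s: "s \<in> Hom C X K" and t: "t \<in> Hom C Y K" by auto
  have "monic C (k \<cdot> s)" "monic C (k \<cdot> t)" using * k monic_Comp by (auto simp: Hom_iff)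
  then obtain W x y where W: "\<not> zero_object C W" "x \<in> Hom C W X" "monic C x" "y \<in> Hom C W Y"
    "monic C y" and eq: "(k \<cdot> s) \<cdot> x = (k \<cdot> t) \<cdot> y"
    using uniform_objectE[OF E Comp_Hom[OF s k(2)] _ _ Comp_Hom[OF t k(2)]] * by metis
  have "k \<cdot> s \<cdot> x = k \<cdot> t \<cdot> y"
    using eq Comp_assoc[OF W(2) s k(2)] Comp_assoc[OF W(4) t k(2)] by simp
  then have "s \<cdot> x = t \<cdot> y"
    by (rule monic_cancel_Hom[OF _ k Comp_Hom[OF W(2) s] Comp_Hom[OF W(4) t]])
  then show "\<exists>W x y. \<not> zero_object C W \<and> x \<in> Hom C W X \<and> monic C x \<and> y \<in> Hom C W Y \<and>
    monic C y \<and> s \<cdot> x = t \<cdot> y"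
    using W by blast
qed

text \<open>Suppose a nonzero \<open>S \<subseteq> K\<close> embeds in \<open>K/N\<close>, and put \<open>V = S \<inter> H \<noteq> 0\<close>.  The kernel \<open>Z\<close> of
  \<open>V \<rightarrow> K/N \<rightarrow> K/(N + H)\<close> embeds in \<open>H/(N \<inter> H)\<close>, so \<open>Z = 0\<close> as \<open>H\<close> is monoform; hence \<open>V\<close>
  embeds in \<open>K/(N + H)\<close>, a quotient of \<open>K/H\<close>.\<close>
lemma uniform_extension_monoform:
  assumes H: "monoform C H" and K: "uniform_object C K" and j: "monic C j" "j \<in> Hom C H K"
    and c: "is_cokernel C c j"
    and no_sub: "\<And>V v. v \<in> Hom C V H \<Longrightarrow> monic C v \<Longrightarrow> subquotient C V (Cod C c) \<Longrightarrow> zero_object C V"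
  shows "monoform C K"
  unfolding monoform_iff
proof (intro conjI allI impI)
  note c' = cokernel_Hom[OF c j(2)]
  have H0: "\<not> zero_object C H" using H by (simp add: monoform_iff)
  show "K \<in> Obj C" using Hom_Obj j by auto
  show "\<not> zero_object C K" using H0 monic_into_zero j by blast
  fix n q S s t
  assume *: "nonzero_subobject C K n \<and> is_cokernel C q n \<and> s \<in> Hom C S K \<and> monic C s \<and>
    t \<in> Hom C S (Cod C q) \<and> monic C t"
  let ?N = "Dom C n"
  let ?R = "Cod C q"
  have n: "n \<in> Hom C ?N K" "monic C n" "\<not> zero_object C ?N"
    using * monic_arrow by (auto simp: nonzero_subobject_def subobject_def Hom_iff)
  have q: "is_cokernel C q n" and s: "s \<in> Hom C S K" "monic C s" and t: "t \<in> Hom C S ?R" "monic C t"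
    using * by auto
  note q' = cokernel_Hom[OF q n(1)]
  show "zero_object C S"
  proof (rule ccontr)
    assume S: "\<not> zero_object C S"
    obtain V x v where V: "\<not> zero_object C V" and x: "x \<in> Hom C V S" "monic C x"
      and v: "v \<in> Hom C V H" "monic C v"
      using uniform_objectE[OF K s S j(2,1) H0] .
    have tx: "t \<cdot> x \<in> Hom C V ?R" using x(1) t(1) by (rule Comp_Hom)
    have tx_mono: "monic C (t \<cdot> x)" using monic_Comp[OF t(2) x(2)] x(1) t(1) by (simp add: Hom_iff)
    have qj: "q \<cdot> j \<in> Hom C H ?R" using j(2) q'(1) by (rule Comp_Hom)
    \<comment> \<open>With K/N as codomain of \<open>q\<close>, the codomain of \<open>d\<close> is
      K/(N + H), and \<open>r\<close> below exhibits it as a quotient of K/H.\<close>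
    obtain d where d: "is_cokernel C d (q \<cdot> j)" using cokernel_exists qj by (auto simp: Hom_iff)
    note d' = cokernel_Hom[OF d qj]
    let ?Q = "Cod C d"
    have dq: "d \<cdot> q \<in> Hom C K ?Q" using q'(1) d'(1) by (rule Comp_Hom)
    have dq_epic: "epic C (d \<cdot> q)"
      using epic_Comp[OF cokernel_epic[OF d] cokernel_epic[OF q]] d'(1) q'(1) by (simp add: Hom_iff)
    have "(d \<cdot> q) \<cdot> j = MZero C H ?Q" using d'(2) Comp_assoc[OF j(2) q'(1) d'(1)] by simp
    then obtain r where r: "r \<in> Hom C (Cod C c) ?Q" "r \<cdot> c = d \<cdot> q"
      using cokernel_factor[OF c j(2) dq] by blast
    have r_epic: "epic C r" using epic_left_factor[OF _ c'(1) r(1)] r(2) dq_epic by simp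
    have dtx: "d \<cdot> t \<cdot> x \<in> Hom C V ?Q" using tx d'(1) by (rule Comp_Hom)
    obtain z where z: "is_kernel C z (d \<cdot> t \<cdot> x)" using kernel_exists dtx by (auto simp: Hom_iff)
    note z' = kernel_Hom[OF z dtx] kernel_monic[OF z]
    let ?Z = "Dom C z"
    \<comment> \<open>\<open>m\<close> is the image of H in K/N, and the kernel of \<open>e\<close>
      is N \<inter> H; so \<open>e\<close> presents this image as H/(N \<inter> H), the quotient to
      which monoformness of H is applied.\<close>
    obtain m where m: "is_kernel C m d" using kernel_exists d' by (auto simp: Hom_iff)
    note m' = kernel_Hom[OF m d'(1)] kernel_monic[OF m]
    let ?I = "Dom C m"
    obtain e where e: "e \<in> Hom C H ?I" "epic C e" "m \<cdot> e = q \<cdot> j"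
      using image_factorization[OF qj d m] .
    obtain k where k: "is_kernel C k e" using kernel_exists e(1) by (auto simp: Hom_iff)
    note k' = kernel_Hom[OF k e(1)] kernel_monic[OF k]
    \<comment> \<open>By uniformity N and H share a nonzero W; it dies in K/N, so \<open>e\<close>
      kills it and it embeds in the kernel of \<open>e\<close>.\<close>
    have "\<not> zero_object C (Dom C k)"
    proof
      assume k0: "zero_object C (Dom C k)"
      obtain W a b where W: "\<not> zero_object C W" and a: "a \<in> Hom C W ?N" "monic C a"
        and b: "b \<in> Hom C W H" "monic C b" and eq: "n \<cdot> a = j \<cdot> b"
        using uniform_objectE[OF K n j(2,1) H0] .
      have "m \<cdot> e \<cdot> b = (q \<cdot> j) \<cdot> b" using e(3) Comp_assoc[OF b(1) e(1) m'(1)] by simp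
      also have "\<dots> = q \<cdot> n \<cdot> a" using eq Comp_assoc[OF b(1) j(2) q'(1)] by simp
      also have "\<dots> = MZero C W ?R"
        using Comp_eq_extend[OF q'(2) a(1) n(1) q'(1)] Comp_MZero(2)[OF a(1)] Hom_Obj[OF q'(1)]
        by simp
      finally have "e \<cdot> b = MZero C W ?I"
        by (rule monic_zeroD[OF m'(3,1) Comp_Hom[OF b(1) e(1)]])
      then obtain u where u: "u \<in> Hom C W (Dom C k)" "k \<cdot> u = b"
        using kernel_factor[OF k e(1) b(1)] by blast
      have "monic C u" using monic_right_factor[OF _ u(1) k'(1)] u(2) b(2) by simp
      then show False using monic_into_zero u(1) k0 W by blast
    qed
    have txz: "(t \<cdot> x) \<cdot> z \<in> Hom C ?Z ?R" using z'(1) tx by (rule Comp_Hom)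
    have txz_mono: "monic C ((t \<cdot> x) \<cdot> z)"
      using monic_Comp[OF tx_mono z'(3)] z'(1) tx by (simp add: Hom_iff)
    have "d \<cdot> (t \<cdot> x) \<cdot> z = MZero C ?Z ?Q" using z'(2) Comp_assoc[OF z'(1) tx d'(1)] by simp
    then obtain b where b: "b \<in> Hom C ?Z ?I" "m \<cdot> b = (t \<cdot> x) \<cdot> z"
      using kernel_factor[OF m d'(1) txz] by blast
    have b_mono: "monic C b" using monic_right_factor[OF _ b(1) m'(1)] b(2) txz_mono by simp
    have vz: "v \<cdot> z \<in> Hom C ?Z H" using z'(1) v(1) by (rule Comp_Hom)
    have vz_mono: "monic C (v \<cdot> z)" using monic_Comp[OF v(2) z'(3)] z'(1) v(1) by (simp add: Hom_iff)
    have "b \<in> Hom C ?Z (Cod C e)" using b(1) e(1) by (simp add: Hom_iff)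
    then have "zero_object C ?Z"
      using monoformD[OF H k'(1,3) epic_cokernel_of_kernel[OF e(2,1) k] vz vz_mono _ b_mono]
        \<open>\<not> zero_object C (Dom C k)\<close> by blast
    then have "monic C (d \<cdot> t \<cdot> x)" using monic_if_kernel_zero[OF dtx z] by blast
    then have "subquotient C V (Cod C c)"
      using subquotient_of_quotient[OF r_epic r(1)] monic_subquotient dtx by blast
    then show False using no_sub v V by blast
  qed
qed

section \<open>Split extensions and vanishing of Ext\<close>

text \<open>The endomorphism \<open>d\<close> = 1 - \<open>i \<cdot> r\<close> kills
  \<open>i\<close>, so it factors through \<open>p\<close> as \<open>s \<cdot> p\<close>; and
  \<open>p \<cdot> d = p\<close> because \<open>p\<close> kills \<open>i\<close>. Cancelling
  \<open>p\<close> makes \<open>s\<close> a section.\<close>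

lemma split_extension_section:
  assumes i: "i \<in> Hom C D Y" and p: "p \<in> Hom C Y X" and ck: "is_cokernel C p i"
    and r: "r \<in> Hom C Y D" "r \<cdot> i = Ident C D"
  obtains s where "s \<in> Hom C X Y" "p \<cdot> s = Ident C X"
proof -
  have O: "D \<in> Obj C" "Y \<in> Obj C" "X \<in> Obj C" using Hom_Obj i p by auto
  have pi: "p \<cdot> i = MZero C D X" using cokernel_Hom(2)[OF ck i] p by (simp add: Hom_iff)
  have ir: "i \<cdot> r \<in> Hom C Y Y" using r(1) i by (rule Comp_Hom)
  obtain d where d: "d \<in> Hom C Y Y" "Ident C Y = MAdd C d (i \<cdot> r)"
    using difference_exists[OF Ident_Hom[OF O(2)] ir] .
  have "(i \<cdot> r) \<cdot> i = i" using Comp_assoc[OF i r(1) i] r(2) Comp_Ident_right[OF i] by simp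
  then have "MAdd C (d \<cdot> i) i = i"
    using Comp_MAdd_left[OF i d(1) ir] d(2) Comp_Ident_left[OF i] by simp
  then have "d \<cdot> i = MZero C D Y" using MAdd_eq_self Comp_Hom[OF i d(1)] i by blast
  then obtain s where "s \<in> Hom C (Cod C p) Y" and sp: "s \<cdot> p = d"
    using cokernel_factor[OF ck i d(1)] by blast
  then have s: "s \<in> Hom C X Y" using p by (simp add: Hom_iff)
  have "p \<cdot> i \<cdot> r = MZero C Y X"
    using Comp_eq_extend[OF pi r(1) i p] Comp_MZero(2)[OF r(1) O(3)] by simp
  then have "p = p \<cdot> d"
    using Comp_MAdd_right[OF d(1) ir p] d(2) Comp_Ident_right[OF p] MAdd_MZero(1)[OF Comp_Hom[OF d(1) p]]
    by simp
  then have "(p \<cdot> s) \<cdot> p = Ident C X \<cdot> p"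
    using sp Comp_assoc[OF p s p] Comp_Ident_left[OF p] by simp
  then have "p \<cdot> s = Ident C X"
    by (rule epic_cancel_Hom[OF _ cokernel_epic[OF ck] p Comp_Hom[OF s p] Ident_Hom[OF O(3)]])
  then show ?thesis using that s by blast
qed

lemma extensionsD:
  assumes "(i, p) \<in> extensions C X D"
  shows "i \<in> Hom C D (Cod C i)" "p \<in> Hom C (Cod C i) X" "is_kernel C i p" "is_cokernel C p i"
    "p \<cdot> i = MZero C D X"
proof -
  show k: "is_kernel C i p" and ck: "is_cokernel C p i" using assms by (auto simp: extensions_def)
  show i: "i \<in> Hom C D (Cod C i)" and "p \<in> Hom C (Cod C i) X"
    using assms monic_arrow[OF kernel_monic[OF k]] cokernel_Hom(1)[OF ck]
    by (auto simp: extensions_def Hom_iff)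
  then show "p \<cdot> i = MZero C D X" using cokernel_Hom(2)[OF ck i] by (simp add: Hom_iff)
qed

text \<open>Without an extension the quotient set \<open>Ext1 C X D\<close> would be empty and not a
  singleton. The biproduct sequence serves as the trivial extension.\<close>

lemma extensions_nonempty:
  assumes "X \<in> Obj C" "D \<in> Obj C"
  shows "extensions C X D \<noteq> {}"
proof -
  obtain P i j p q where "is_biproduct C D X P i j p q" using biproduct_exists[OF assms(2,1)] by blast
  then have i: "i \<in> Hom C D P" and j: "j \<in> Hom C X P" and p: "p \<in> Hom C P D" and q: "q \<in> Hom C P X"
    and pi: "p \<cdot> i = Ident C D" and qj: "q \<cdot> j = Ident C X"
    and sum: "MAdd C (i \<cdot> p) (j \<cdot> q) = Ident C P"
    by (auto simp: is_biproduct_def)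
  have ip: "i \<cdot> p \<in> Hom C P P" and jq: "j \<cdot> q \<in> Hom C P P" using Comp_Hom i j p q by blast+
  have P: "P \<in> Obj C" using Hom_Obj i by auto
  have mi: "monic C i" using monic_right_factor[OF _ i p] monic_Ident pi assms by simp
  have eq: "epic C q" using epic_left_factor[OF _ j q] epic_Ident qj assms by simp
  \<comment> \<open>\<open>is_biproduct\<close> does not list \<open>q \<cdot> i = 0\<close>. It
    follows by composing \<open>q\<close> with the identity \<open>i \<cdot> p\<close> +
    \<open>j \<cdot> q\<close>: this gives \<open>q \<cdot> i \<cdot> p = 0\<close>, and
    \<open>p\<close> is epic.\<close>
  have "q \<cdot> j \<cdot> q = q" using Comp_eq_extend[OF qj q j q] Comp_Ident_left[OF q] by simp
  then have "MAdd C (q \<cdot> i \<cdot> p) q = q"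
    using Comp_MAdd_right[OF ip jq q] sum Comp_Ident_right[OF q] by simp
  then have "q \<cdot> i \<cdot> p = MZero C P X" using MAdd_eq_self Comp_Hom[OF ip q] q by blast
  then have "(q \<cdot> i) \<cdot> p = MZero C P X" using Comp_assoc[OF p i q] by simp
  moreover have "epic C p" using epic_left_factor[OF _ i p] epic_Ident pi assms by simp
  ultimately have qi: "q \<cdot> i = MZero C D X" using epic_zeroD[OF _ p Comp_Hom[OF i q]] by blast
  have "is_kernel C i q"
  proof (rule is_kernelI[OF mi i q qi])
    fix W x assume x: "x \<in> Hom C W P" "q \<cdot> x = MZero C W X"
    have "(j \<cdot> q) \<cdot> x = MZero C W P"
      using Comp_assoc[OF x(1) q j] x(2) Comp_MZero(1)[OF j] Hom_Obj[OF x(1)] by simp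
    then have "x = (i \<cdot> p) \<cdot> x"
      using Comp_MAdd_left[OF x(1) ip jq] sum Comp_Ident_left[OF x(1)]
        MAdd_MZero(1)[OF Comp_Hom[OF x(1) ip]] by simp
    then show "\<exists>u\<in>Hom C W D. i \<cdot> u = x"
      using Comp_assoc[OF x(1) p i] Comp_Hom[OF x(1) p] by metis
  qed
  moreover have "is_cokernel C q i"
  proof (rule is_cokernelI[OF eq q i qi])
    fix W x assume x: "x \<in> Hom C P W" "x \<cdot> i = MZero C D W"
    have "x \<cdot> i \<cdot> p = MZero C P W"
      using Comp_eq_extend[OF x(2) p i x(1)] Comp_MZero(2)[OF p] Hom_Obj[OF x(1)] by simp
    then have "x = x \<cdot> j \<cdot> q"
      using Comp_MAdd_right[OF ip jq x(1)] sum Comp_Ident_right[OF x(1)]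
        MAdd_MZero(2)[OF Comp_Hom[OF jq x(1)]] by simp
    then show "\<exists>u\<in>Hom C X W. u \<cdot> q = x"
      using Comp_assoc[OF q j x(1)] Comp_Hom[OF j x(1)] by metis
  qed
  ultimately have "(i, q) \<in> extensions C X D" using i q by (simp add: extensions_def Hom_iff)
  then show ?thesis by blast
qed

text \<open>The comparison map is \<open>i' \<cdot> r\<close> + \<open>s \<cdot> p\<close>, built
  from the retraction of the first extension and a section of the second. It is compatible with both
  ends, and a short diagram chase makes it monic and epic, hence invertible.\<close>

lemma split_extensions_related:
  assumes ip: "(i, p) \<in> extensions C X D" and ip': "(i', p') \<in> extensions C X D"
    and r: "r \<in> Hom C (Cod C i) D" "r \<cdot> i = Ident C D"
    and r': "r' \<in> Hom C (Cod C i') D" "r' \<cdot> i' = Ident C D"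
  shows "((i, p), (i', p')) \<in> ext_rel C X D"
proof -
  note E = extensionsD[OF ip] and E' = extensionsD[OF ip']
  let ?Y = "Cod C i" and ?Y' = "Cod C i'"
  have O: "D \<in> Obj C" "X \<in> Obj C" "?Y \<in> Obj C" "?Y' \<in> Obj C" using Hom_Obj E(1,2) E'(1) by auto
  obtain s where s: "s \<in> Hom C X ?Y'" "p' \<cdot> s = Ident C X"
    using split_extension_section[OF E'(1,2,4) r'] .
  let ?a = "i' \<cdot> r" and ?b = "s \<cdot> p"
  have a: "?a \<in> Hom C ?Y ?Y'" using r(1) E'(1) by (rule Comp_Hom)
  have b: "?b \<in> Hom C ?Y ?Y'" using E(2) s(1) by (rule Comp_Hom)
  let ?f = "MAdd C ?a ?b"
  have f: "?f \<in> Hom C ?Y ?Y'" using a b by (rule MAdd_Hom)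
  have "?a \<cdot> i = i'" using Comp_assoc[OF E(1) r(1) E'(1)] r(2) Comp_Ident_right[OF E'(1)] by simp
  moreover have "?b \<cdot> i = MZero C D ?Y'"
    using Comp_assoc[OF E(1,2) s(1)] E(5) Comp_MZero(1)[OF s(1) O(1)] by simp
  ultimately have fi: "?f \<cdot> i = i'"
    using Comp_MAdd_left[OF E(1) a b] MAdd_MZero(1)[OF E'(1)] by simp
  have "p' \<cdot> ?a = MZero C ?Y X"
    using Comp_eq_extend[OF E'(5) r(1) E'(1,2)] Comp_MZero(2)[OF r(1) O(2)] by simp
  moreover have "p' \<cdot> ?b = p"
    using Comp_eq_extend[OF s(2) E(2) s(1) E'(2)] Comp_Ident_left[OF E(2)] by simp
  ultimately have pf: "p' \<cdot> ?f = p"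
    using Comp_MAdd_right[OF a b E'(2)] MAdd_MZero(2)[OF E(2)] by simp
  have "monic C ?f"
  proof (rule monicI_zero[OF f])
    fix W x assume x: "x \<in> Hom C W ?Y" "?f \<cdot> x = MZero C W ?Y'"
    have W: "W \<in> Obj C" using Hom_Obj x by auto
    have "p \<cdot> x = p' \<cdot> ?f \<cdot> x" using Comp_eq_extend[OF pf x(1) f E'(2)] by simp
    also have "\<dots> = MZero C W X" using x(2) Comp_MZero(1)[OF E'(2) W] by simp
    finally obtain u where "u \<in> Hom C W (Dom C i)" and u: "i \<cdot> u = x"
      using kernel_factor[OF E(3,2) x(1)] by blast
    then have u1: "u \<in> Hom C W D" using E(1) by (simp add: Hom_iff)
    have "i' \<cdot> u = ?f \<cdot> i \<cdot> u" using Comp_eq_extend[OF fi u1 E(1) f] by simp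
    then have "i' \<cdot> u = MZero C W ?Y'" using u x(2) by simp
    then have "u = MZero C W D" by (rule monic_zeroD[OF kernel_monic[OF E'(3)] E'(1) u1])
    then show "x = MZero C W ?Y" using u Comp_MZero(1)[OF E(1) W] by simp
  qed
  moreover have "epic C ?f"
  proof (rule epicI_zero[OF f])
    fix W x assume x: "x \<in> Hom C ?Y' W" "x \<cdot> ?f = MZero C ?Y W"
    have W: "W \<in> Obj C" using Hom_Obj x by auto
    have "x \<cdot> i' = (x \<cdot> ?f) \<cdot> i" using fi Comp_assoc[OF E(1) f x(1)] by simp
    also have "\<dots> = MZero C D W" using x(2) Comp_MZero(2)[OF E(1) W] by simp
    finally obtain u where "u \<in> Hom C (Cod C p') W" and u: "u \<cdot> p' = x"
      using cokernel_factor[OF E'(4,1) x(1)] by blast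
    then have u1: "u \<in> Hom C X W" using E'(2) by (simp add: Hom_iff)
    have "u \<cdot> p = (u \<cdot> p') \<cdot> ?f" using pf Comp_assoc[OF f E'(2) u1] by simp
    then have "u \<cdot> p = MZero C ?Y W" using u x(2) by simp
    then have "u = MZero C X W" by (rule epic_zeroD[OF cokernel_epic[OF E(4)] E(2) u1])
    then show "x = MZero C ?Y' W" using u Comp_MZero(2)[OF E'(2) W] by simp
  qed
  ultimately have "isomorphism C ?f" by (rule monic_epic_isomorphism)
  then show ?thesis unfolding ext_rel_def using ip ip' f fi pf by blast
qed

text \<open>Any two split extensions are related, so every class is the whole of
  \<open>extensions C X D\<close>.\<close>

lemma Ext1_singleton_if_split:
  assumes "X \<in> Obj C" "D \<in> Obj C"
    and split: "\<And>i p. (i, p) \<in> extensions C X D \<Longrightarrow> \<exists>r\<in>Hom C (Cod C i) D. r \<cdot> i = Ident C D"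
  shows "is_singleton (Ext1 C X D)"
proof -
  have "((i, p), (i', p')) \<in> ext_rel C X D"
    if "(i, p) \<in> extensions C X D" "(i', p') \<in> extensions C X D" for i p i' p'
    using split_extensions_related[OF that] split that by blast
  then have "ext_rel C X D `` {e} = extensions C X D" if "e \<in> extensions C X D" for e
    using that by (cases e) (auto simp: ext_rel_def)
  then have "Ext1 C X D = {extensions C X D}"
    using extensions_nonempty[OF assms(1,2)] by (auto simp: Ext1_def quotient_def)
  then show ?thesis by (simp add: is_singleton_def)
qed

section \<open>Subobjects of the envelope, torsion, and the splitting\<close>

text \<open>By reflexivity of \<open>atom_le\<close>, \<alpha> lies in its own closure, which the
  support of \<open>T\<close> avoids.\<close>

lemma not_in_ASupp_localizing:
  assumes "\<alpha> \<in> ASpec C" "T \<in> localizing_at C \<alpha>" "K \<in> \<alpha>"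
  shows "\<not> subquotient C K T"
proof
  assume "subquotient C K T"
  then have "\<alpha> \<in> ASupp C T" using assms by (auto simp: ASupp_def)
  moreover have "\<alpha> \<in> atom_closure C \<alpha>" using assms by (simp add: atom_closure_def atom_le_def)
  ultimately show False using assms(2) by (auto simp: localizing_at_def)
qed

text \<open>For the second claim, S meets H by essentiality, while H shares a nonzero subobject with
  the representative H1 of the class \<alpha>. Uniformity of H merges the two into a nonzero U
  embedded in both S and H1, which carries out transitivity of \<open>atom_rel\<close> at this
  spot.\<close>

lemma atom_envelope_uniform:
  assumes \<alpha>: "\<alpha> \<in> ASpec C" and E: "is_atom_envelope C \<alpha> E"
  shows "uniform_object C E"
    and "s \<in> Hom C S E \<Longrightarrow> monic C s \<Longrightarrow> monoform C S \<Longrightarrow> S \<in> \<alpha>"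
proof -
  obtain H m where H: "H \<in> \<alpha>" and m: "essential_monic C m" "m \<in> Hom C H E"
    using E by (auto simp: is_atom_envelope_def is_injective_envelope_def)
  obtain H1 where \<alpha>': "\<alpha> = atom_rel C `` {H1}"
    using \<alpha> by (auto simp: ASpec_def elim: quotientE)
  then have rel: "(H1, H) \<in> atom_rel C" using H by simp
  then have mono: "monoform C H1" "monoform C H" by (simp_all add: atom_rel_iff)
  show "uniform_object C E" using essential_extension_uniform m monoform_uniform mono by blast
  assume s: "s \<in> Hom C S E" "monic C s" and S: "monoform C S"
  then have "\<not> zero_object C S" by (simp add: monoform_iff)
  then obtain W x y where W: "\<not> zero_object C W" and x: "x \<in> Hom C W H" "monic C x"
    and y: "y \<in> Hom C W S" "monic C y"
    using essential_monic_meets[OF m s(2,1)] by metis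
  obtain V a b where V: "\<not> zero_object C V" and a: "a \<in> Hom C V H1" "monic C a"
    and b: "b \<in> Hom C V H" "monic C b"
    using rel unfolding atom_rel_iff by blast
  obtain U u v where U: "\<not> zero_object C U" and u: "u \<in> Hom C U W" "monic C u"
    and v: "v \<in> Hom C U V" "monic C v"
    using uniform_objectE[OF monoform_uniform[OF mono(2)] x W b V] .
  have "monic C (a \<cdot> v)" "monic C (y \<cdot> u)"
    using monic_Comp a v y u by (auto simp: Hom_iff)
  then have "(H1, S) \<in> atom_rel C"
    unfolding atom_rel_iff using mono S U Comp_Hom[OF v(1) a(1)] Comp_Hom[OF u(1) y(1)] by blast
  then show "S \<in> \<alpha>" using \<alpha>' by simp
qed

lemma atom_envelope_injective: "is_atom_envelope C \<alpha> E \<Longrightarrow> injective_object C E"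
  by (auto simp: is_atom_envelope_def is_injective_envelope_def)

text \<open>A nonzero radical of H would be a monoform subobject of E, hence a member of \<alpha>;
  but it belongs to the localizing subcategory and is a subquotient of itself.\<close>

lemma monoform_subobject_torsion_free:
  assumes \<alpha>: "\<alpha> \<in> ASpec C" and E: "is_atom_envelope C \<alpha> E"
    and h: "h \<in> Hom C H E" "monic C h" and H: "monoform C H"
    and t: "is_radical_at C \<alpha> t"
  shows "torsion_free C t H"
proof (rule ccontr)
  have HO: "H \<in> Obj C" using H by (simp add: monoform_iff)
  let ?T = "Dom C (t H)"
  assume "\<not> torsion_free C t H"
  then have T0: "\<not> zero_object C ?T" using HO by (simp add: torsion_free_def)
  have T: "?T \<in> localizing_at C \<alpha>" and tH: "monic C (t H)" "t H \<in> Hom C ?T H"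
    using t HO monic_arrow by (auto simp: is_radical_at_def subobject_def Hom_iff)
  have "monoform C ?T" using monoform_nonzero_subobject[OF H tH T0] .
  moreover have "h \<cdot> t H \<in> Hom C ?T E" "monic C (h \<cdot> t H)"
    using Comp_Hom[OF tH(2) h(1)] monic_Comp[OF h(2) tH(1)] h(1) tH(2) by (auto simp: Hom_iff)
  ultimately have "?T \<in> \<alpha>" using atom_envelope_uniform(2)[OF \<alpha> E] by blast
  moreover have "subquotient C ?T ?T"
    using monic_subquotient monic_Ident Ident_Hom Hom_Obj(1)[OF tH(2)] by blast
  ultimately show False using not_in_ASupp_localizing[OF \<alpha> T] by blast
qed

text \<open>Torsion of X enters as an epic from some \<open>T\<close> in the localizing subcategory.
  Subquotients of K/H are pulled back to \<open>T\<close> itself, so membership in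
  \<open>localizing_at\<close> need not be transported to X.\<close>

lemma maximal_monoform_extension_splits:
  assumes \<alpha>: "\<alpha> \<in> ASpec C" and E: "is_atom_envelope C \<alpha> E"
    and max: "maximal_monoform_subobject C E h" and T: "T \<in> localizing_at C \<alpha>"
    and f: "f \<in> Hom C T X" "epic C f" and ip: "(i, p) \<in> extensions C X (Dom C h)"
  shows "\<exists>r\<in>Hom C (Cod C i) (Dom C h). r \<cdot> i = Ident C (Dom C h)"
proof -
  let ?H = "Dom C h" and ?Y = "Cod C i"
  note i = extensionsD[OF ip]
  have H: "monoform C ?H" and h: "monic C h" "h \<in> Hom C ?H E"
    using max monic_arrow by (auto simp: maximal_monoform_subobject_def subobject_def Hom_iff)
  have "Dom C i = ?H" using i(1) by (simp add: Hom_iff)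
  then obtain g where g: "g \<in> Hom C ?Y E" "g \<cdot> i = h"
    using atom_envelope_injective[OF E] kernel_monic[OF i(3)] h(2)
    unfolding injective_object_def by metis
  obtain K e k where e: "e \<in> Hom C ?Y K" "epic C e" and k: "k \<in> Hom C K E" "monic C k"
    and ke: "k \<cdot> e = g" using epic_monic_factorization[OF g(1)] .
  let ?j = "e \<cdot> i"
  have j: "?j \<in> Hom C ?H K" using i(1) e(1) by (rule Comp_Hom)
  have kj: "k \<cdot> ?j = h" using ke g(2) Comp_assoc[OF i(1) e(1) k(1)] by simp
  have j_mono: "monic C ?j" using monic_right_factor[OF _ j k(1)] kj h(1) by simp
  obtain c where c: "is_cokernel C c ?j" using cokernel_exists j by (auto simp: Hom_iff)
  note c' = cokernel_Hom[OF c j]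
  have ce: "c \<cdot> e \<in> Hom C ?Y (Cod C c)" using e(1) c'(1) by (rule Comp_Hom)
  have ce_epic: "epic C (c \<cdot> e)"
    using epic_Comp[OF cokernel_epic[OF c] e(2)] c'(1) e(1) by (simp add: Hom_iff)
  have "(c \<cdot> e) \<cdot> i = MZero C ?H (Cod C c)" using c'(2) Comp_assoc[OF i(1) e(1) c'(1)] by simp
  \<comment> \<open>\<open>c \<cdot> e\<close> kills H inside Y, so it descends to X: K/H becomes a
    quotient of X, and then of \<open>T\<close> through \<open>q \<cdot> f\<close>.\<close>
  then obtain q where "q \<in> Hom C (Cod C p) (Cod C c)" and qp: "q \<cdot> p = c \<cdot> e"
    using cokernel_factor[OF i(4,1) ce] by blast
  then have q: "q \<in> Hom C X (Cod C c)" using i(2) by (simp add: Hom_iff)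
  have "epic C q" using epic_left_factor[OF _ i(2) q] qp ce_epic by simp
  then have qf: "epic C (q \<cdot> f)" using epic_Comp f q by (auto simp: Hom_iff)
  have "monoform C K"
  proof (rule uniform_extension_monoform[OF H _ j_mono j c])
    show "uniform_object C K" using uniform_subobject atom_envelope_uniform(1)[OF \<alpha> E] k by blast
    fix V v assume v: "v \<in> Hom C V ?H" "monic C v" and V: "subquotient C V (Cod C c)"
    show "zero_object C V"
    proof (rule ccontr)
      assume "\<not> zero_object C V"
      then have "monoform C V" using monoform_nonzero_subobject[OF H v(2,1)] by blast
      moreover have "h \<cdot> v \<in> Hom C V E" "monic C (h \<cdot> v)"
        using Comp_Hom[OF v(1) h(2)] monic_Comp[OF h(1) v(2)] h(2) v(1) by (auto simp: Hom_iff)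
      ultimately have "V \<in> \<alpha>" using atom_envelope_uniform(2)[OF \<alpha> E] by blast
      then show False
        using not_in_ASupp_localizing[OF \<alpha> T] subquotient_of_quotient[OF qf Comp_Hom[OF f(1) q] V]
        by blast
    qed
  qed
  moreover have "sub_le C h k" unfolding sub_le_def using j kj k(1) by (auto simp: Hom_iff)
  ultimately have "sub_le C k h"
    using max k by (auto simp: maximal_monoform_subobject_def subobject_def Hom_iff)
  then obtain a where a: "a \<in> Hom C K ?H" "h \<cdot> a = k"
    unfolding sub_le_def using k(1) by (auto simp: Hom_iff)
  have ae: "a \<cdot> e \<in> Hom C ?Y ?H" using e(1) a(1) by (rule Comp_Hom)
  have H': "?H \<in> Obj C" using Hom_Obj h by auto
  \<comment> \<open>\<open>a\<close> expresses K \<le> H inside E. Both \<open>a \<cdot> ?j\<close>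
    and the identity of H become \<open>h\<close> after composition with the monic \<open>h\<close>,
    so they agree and \<open>a \<cdot> e\<close> is the retraction.\<close>
  have "h \<cdot> a \<cdot> ?j = h \<cdot> Ident C ?H"
    using Comp_eq_extend[OF a(2) j a(1) h(2)] kj Comp_Ident_right[OF h(2)] by simp
  then have "a \<cdot> ?j = Ident C ?H"
    by (rule monic_cancel_Hom[OF _ h Comp_Hom[OF j a(1)] Ident_Hom[OF H']])
  then have "(a \<cdot> e) \<cdot> i = Ident C ?H" using Comp_assoc[OF i(1) e(1) a(1)] by simp
  then show ?thesis using ae by blast
qed

end

theorem corollary3p9:
  fixes A :: "('o, 'm, 'x) additive_data_scheme"
    and \<alpha> :: "'o set" and E :: 'o and h :: 'm and t :: "'o \<Rightarrow> 'm"
  assumes "locally_noetherian_grothendieck_category TYPE('u) A"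
    and "\<alpha> \<in> ASpec A"
    and "is_atom_envelope A \<alpha> E"
    and "maximal_monoform_subobject A E h"
    and "is_radical_at A \<alpha> t"
  shows "faithfully_injective A t (Dom A h)"
proof -
  interpret abelian_category A
    using assms(1) by (simp add: locally_noetherian_grothendieck_category_def grothendieck_category_def)
  let ?H = "Dom A h"
  have H: "monoform A ?H" and h: "h \<in> Hom A ?H E" "monic A h"
    using assms(4) monic_arrow by (auto simp: maximal_monoform_subobject_def subobject_def Hom_iff)
  have HO: "?H \<in> Obj A" using Hom_Obj h by auto
  have "is_singleton (Ext1 A X ?H)" if "torsion A t X" for X
  proof -
    have X: "X \<in> Obj A" and iso: "isomorphism A (t X)" using that by (auto simp: torsion_def)
    \<comment> \<open>For torsion X the inclusion \<open>t X\<close> is an isomorphism, so it is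
      itself the required epic from an object of the localizing subcategory.\<close>
    have "Dom A (t X) \<in> localizing_at A \<alpha>" "t X \<in> Hom A (Dom A (t X)) X" "epic A (t X)"
      using assms(5) X isomorphism_epic[OF iso] epic_arrow
      by (auto simp: is_radical_at_def subobject_def Hom_iff)
    then show ?thesis
      using Ext1_singleton_if_split[OF X HO] maximal_monoform_extension_splits[OF assms(2-4)] by blast
  qed
  then show ?thesis
    using monoform_subobject_torsion_free[OF assms(2,3) h H assms(5)]
    by (simp add: faithfully_injective_def)
qed

end
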